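(* Let $0<p<\infty$, $\alpha>-1$, $a\in\mathbb{D}$ and let $N$ be a positive integer. If $f\in A^p_\alpha$ satisfies $f(a)=f'(a)=\dots=f^{(N-1)}(a)=0$, then $f/\varphi_a^N$ (extended analytically to $z=a$) belongs to $A^p_\alpha$ and $$\left\|\frac{f}{\varphi_a^N}\right\|_{p,\alpha}\le\left(\frac{\Gamma\left(\frac{Np}{2}+2+\alpha\right)}{\Gamma(2+\alpha)\,\Gamma\left(\frac{Np}{2}+1\right)}\right)^{1/p}\|f\|_{p,\alpha},$$ and the inequality is sharp (equality is attained by a nonzero function in $A^p_\alpha$ with such a zero at $a$). In particular, for the unweighted Bergman space $A^p=A^p_0$ and $N=1$: if $f\in A^p$ and $f(a)=0$, then $$\left\|\frac{f}{\varphi_a}\right\|_{p}\le\left(\frac{p+2}{2}\right)^{1/p}\|f\|_p.$$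
   Context: $\mathbb{D}$ is the unit disk and $dA(z)=\pi^{-1}\,dx\,dy$ the normalized area measure on $\mathbb{D}$. For $\alpha>-1$ and $0<p<\infty$, $A^p_\alpha$ is the space of analytic functions $f$ on $\mathbb{D}$ with $$\|f\|_{p,\alpha}=\left(\int_{\mathbb{D}}|f(z)|^p(\alpha+1)(1-|z|^2)^\alpha\,dA(z)\right)^{1/p}<\infty$$ (for $0<p<1$ this is not a norm but the same notation is used); $\|\cdot\|_p$ denotes $\|\cdot\|_{p,0}$. For $a\in\mathbb{D}$, $\varphi_a(z)=\frac{a-z}{1-\overline{a}z}$. $\Gamma$ is the Euler Gamma function. *)

theory Defs
  imports "HOL-Analysis.Analysis"
begin

definition disc_aut :: "complex \<Rightarrow> complex \<Rightarrow> complex" where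
  "disc_aut a z = (a - z) / (1 - cnj a * z)"

text \<open>The p-th power integral of |f| against (alpha+1)(1-|z|^2)^alpha dA(z),
  with dA = (1/pi) dx dy the normalized area measure on the unit disk
  (Lebesgue measure on the complex plane identified with R^2).\<close>
definition bergman_integral :: "real \<Rightarrow> real \<Rightarrow> (complex \<Rightarrow> complex) \<Rightarrow> ennreal" where
  "bergman_integral p \<alpha> f =
     (\<integral>\<^sup>+ z \<in> ball 0 1. ennreal (norm (f z) powr p * (\<alpha> + 1) * (1 - (norm z)\<^sup>2) powr \<alpha> / pi) \<partial>lborel)"

definition in_bergman :: "real \<Rightarrow> real \<Rightarrow> (complex \<Rightarrow> complex) \<Rightarrow> bool" where
  "in_bergman p \<alpha> f \<longleftrightarrow> f holomorphic_on ball 0 1 \<and> bergman_integral p \<alpha> f < \<infinity>"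

definition bergman_norm :: "real \<Rightarrow> real \<Rightarrow> (complex \<Rightarrow> complex) \<Rightarrow> real" where
  "bergman_norm p \<alpha> f = enn2real (bergman_integral p \<alpha> f) powr (1 / p)"

end

theory Submission
  imports Defs "HOL-Complex_Analysis.Complex_Analysis"
begin

text \<open>
  Write \<open>f = g \<phi>\<^sup>N\<close> with \<open>\<phi> = disc_aut a\<close>. The substitution \<open>z = \<phi> w\<close> turns the two integrals into those of
  \<open>\<bar>G w\<bar>\<^sup>p\<close> and \<open>\<bar>G w\<bar>\<^sup>p \<bar>w\<bar>\<^sup>N\<^sup>p\<close>, where \<open>G w = g (\<phi> w) k w\<close> and \<open>k\<close> is a holomorphic
  branch of \<open>\<phi>'\<close> to the power \<open>(2 + \<alpha>) / p\<close>. The circular means of \<open>\<bar>G\<bar>\<^sup>p\<close> increase with the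
  radius, as does \<open>\<bar>w\<bar>\<^sup>N\<^sup>p\<close>, so Chebyshev's inequality for the radial probability measure
  \<open>(\<alpha> + 1) (1 - \<bar>w\<bar>\<^sup>2)\<^sup>\<alpha> dA\<close> bounds the quotient of the integrals by the reciprocal of a Beta
  integral. Equality holds when \<open>\<bar>G\<bar>\<close> is constant, which is the case for \<open>g = k\<close>.

  Monotonicity of the means is obtained without subharmonic function theory: finite sums
  \<open>\<bar>g\<^sub>1\<bar>\<^sup>p + \<dots> + \<bar>g\<^sub>n\<bar>\<^sup>p\<close> satisfy the maximum principle, and this is applied to the
  rotates of \<open>G\<close> by the \<open>n\<close>-th roots of unity for large \<open>n\<close>.
\<close>

section \<open>Holomorphic substitution in area integrals\<close>

text \<open>The change of variables theorem of the library is only available on \<open>real^'n\<close>.\<close>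

definition complex_of_vec :: "real^2 \<Rightarrow> complex" where
  "complex_of_vec x = Complex (x $ 1) (x $ 2)"

definition vec_of_complex :: "complex \<Rightarrow> real^2" where
  "vec_of_complex z = (\<chi> i. if i = 1 then Re z else Im z)"

lemma vec_of_complex_nth [simp]: "vec_of_complex z $ 1 = Re z" "vec_of_complex z $ 2 = Im z"
  by (auto simp: vec_of_complex_def)

lemma vec_of_complex_inverse [simp]: "complex_of_vec (vec_of_complex z) = z"
  by (simp add: complex_of_vec_def)

lemma complex_of_vec_inverse [simp]: "vec_of_complex (complex_of_vec x) = x"
  by (simp add: complex_of_vec_def vec_eq_iff forall_2)

lemma bounded_linear_complex_of_vec: "bounded_linear complex_of_vec"
  by (intro linear_conv_bounded_linear[THEN iffD1] linearI)
     (auto simp: complex_of_vec_def complex_eq_iff)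

lemma bounded_linear_vec_of_complex: "bounded_linear vec_of_complex"
  by (intro linear_conv_bounded_linear[THEN iffD1] linearI)
     (auto simp: vec_eq_iff forall_2)

lemma borel_measurable_complex_of_vec [measurable]: "complex_of_vec \<in> borel_measurable borel"
  by (intro borel_measurable_continuous_onI linear_continuous_on bounded_linear_complex_of_vec)

text \<open>Lebesgue measure is determined by its values on open boxes, and the preimage of a box is
  the box with the corresponding corners.\<close>

lemma distr_complex_of_vec: "distr lborel borel complex_of_vec = lborel"
proof (rule lborel_eqI[symmetric])
  fix l u :: complex assume le: "\<And>b. b \<in> Basis \<Longrightarrow> l \<bullet> b \<le> u \<bullet> b"
  have eq: "complex_of_vec -` box l u = box (vec_of_complex l) (vec_of_complex u)"
    by (auto simp: mem_box_cart forall_2 complex_of_vec_def in_box_complex_iff)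
  have le': "Re l \<le> Re u" "Im l \<le> Im u"
    using le[of 1] le[of \<i>] by (auto simp: Basis_complex_def)
  have B: "(Basis :: (real^2) set) = {axis 1 1, axis 2 1}"
    by (auto simp: Basis_vec_def UNIV_2)
  have ax: "axis 1 1 \<noteq> (axis 2 1 :: real^2)"
    by (simp add: axis_eq_axis)
  have *: "\<And>b. b \<in> Basis \<Longrightarrow> vec_of_complex l \<bullet> b \<le> vec_of_complex u \<bullet> b"
    using le' by (auto simp: B inner_axis)
  have "emeasure (distr lborel borel complex_of_vec) (box l u) =
     (\<Prod>b\<in>Basis. (vec_of_complex u - vec_of_complex l) \<bullet> b)"
    by (subst emeasure_distr) (auto simp: eq emeasure_lborel_box[OF *])
  also have "(\<Prod>b\<in>Basis. (vec_of_complex u - vec_of_complex l) \<bullet> b) = (\<Prod>b\<in>Basis. (u - l) \<bullet> b)"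
    using ax by (simp add: B Basis_complex_def inner_axis)
  finally show "emeasure (distr lborel borel complex_of_vec) (box l u) = (\<Prod>b\<in>Basis. (u - l) \<bullet> b)" .
qed simp

section \<open>Nonnegative integrals and absolute integrability\<close>

text \<open>If neither side is a finite value, both are \<open>top\<close>. An equality of
  nonnegative integrals thus follows from a theorem that speaks only of finite integrals.\<close>

lemma ennreal_eqI_real:
  assumes "\<And>b. 0 \<le> b \<Longrightarrow> x = ennreal b \<longleftrightarrow> y = ennreal b"
  shows "x = y"
proof (cases x)
  case (real r)
  with assms[of r] show ?thesis by simp
next
  case top
  with assms show ?thesis by (cases y) auto
qed

text \<open>Translates a finite value of an \<open>ennreal\<close> integral into the pair of
  conditions that the change of variables theorem handles.\<close>

lemma nn_integral_eq_iff_absolutely_integrable: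
  fixes f :: "'a::euclidean_space \<Rightarrow> real"
  assumes f: "(\<lambda>x. f x * indicator S x) \<in> borel_measurable borel" and nonneg: "\<And>x. x \<in> S \<Longrightarrow> 0 \<le> f x"
    and "0 \<le> b"
  shows "(\<integral>\<^sup>+x\<in>S. ennreal (f x) \<partial>lborel) = ennreal b \<longleftrightarrow>
         f absolutely_integrable_on S \<and> integral S f = b"
proof
  assume L: "(\<integral>\<^sup>+x\<in>S. ennreal (f x) \<partial>lborel) = ennreal b"
  have "(\<integral>\<^sup>+x. ennreal (f x * indicator S x) \<partial>lborel) = ennreal b"
    unfolding L[symmetric] by (intro nn_integral_cong) (auto simp: indicator_def)
  then have "((\<lambda>x. f x * indicator S x) has_integral b) UNIV"
    by (intro nn_integral_has_integral f) (use nonneg \<open>0 \<le> b\<close> in \<open>auto simp: indicator_def\<close>)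
  moreover have "(\<lambda>x. f x * indicator S x) = (\<lambda>x. if x \<in> S then f x else 0)"
    by (auto simp: indicator_def)
  ultimately have "(f has_integral b) S"
    by (simp add: has_integral_restrict_UNIV)
  then show "f absolutely_integrable_on S \<and> integral S f = b"
    using nonneg by (auto intro!: nonnegative_absolutely_integrable_1)
next
  assume "f absolutely_integrable_on S \<and> integral S f = b"
  then have "(f has_integral b) S"
    using absolutely_integrable_on_def by (metis has_integral_integral)
  then show "(\<integral>\<^sup>+x\<in>S. ennreal (f x) \<partial>lborel) = ennreal b"
    using nonneg by (intro nn_integral_has_integral_lebesgue')
qed

text \<open>The change of variables theorem is applied to vector-valued integrands; a real function
  enters it as a \<open>real^1\<close>-valued one.\<close>

lemma absolutely_integrable_vec1_iff:
  fixes f :: "'a::euclidean_space \<Rightarrow> real"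
  shows "((\<lambda>x. vec (f x) :: real^1) absolutely_integrable_on S \<and> integral S (\<lambda>x. vec (f x) :: real^1) = vec b)
     \<longleftrightarrow> (f absolutely_integrable_on S \<and> integral S f = b)"
proof -
  have c: "(\<lambda>x. (vec (f x) :: real^1) \<bullet> axis 1 1) = f" by (simp add: inner_axis)
  have B: "(Basis :: (real^1) set) = {axis 1 1}" by (auto simp: Basis_vec_def UNIV_1)
  have i: "(\<lambda>x. vec (f x) :: real^1) absolutely_integrable_on S \<longleftrightarrow> f absolutely_integrable_on S"
    by (subst absolutely_integrable_componentwise_iff) (simp add: B c)
  have "integral S (\<lambda>x. vec (f x) :: real^1) = vec (integral S f)" if "f integrable_on S"
  proof (rule integral_unique)
    have "((\<lambda>x. vec (f x) :: real^1) has_integral vec (integral S f)) S \<longleftrightarrow> (f has_integral integral S f) S"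
      by (subst has_integral_componentwise_iff) (simp add: B c inner_axis)
    then show "((\<lambda>x. vec (f x) :: real^1) has_integral vec (integral S f)) S"
      using that by (simp add: has_integral_integral)
  qed
  then have "f absolutely_integrable_on S \<Longrightarrow> integral S (\<lambda>x. vec (f x) :: real^1) = vec (integral S f)"
    by (auto simp: absolutely_integrable_on_def)
  moreover have "(vec x :: real^1) = vec y \<longleftrightarrow> x = y" for x y :: real
    by (simp add: vec_eq_iff)
  ultimately show ?thesis
    using i by metis
qed

text \<open>The matrix has rows \<open>Re c, - Im c\<close> and \<open>Im c, Re c\<close>: a
  rotation scaled by \<open>norm c\<close>.\<close>

lemma det_matrix_complex_mult:
  "det (matrix (\<lambda>x. vec_of_complex (c * complex_of_vec x))) = (norm c)\<^sup>2"
  by (simp add: det_2 matrix_def axis_def complex_of_vec_def cmod_def power2_eq_square)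

text \<open>The real Jacobian of a holomorphic map is the squared modulus of its derivative. Both
  integrals are carried over to \<open>real^2\<close> and compared at each finite value, so that no
  finiteness has to be assumed.\<close>

theorem nn_integral_holomorphic_substitution:
  fixes h :: "complex \<Rightarrow> real"
  assumes S: "open S" and hol: "\<phi> holomorphic_on S" and inj: "inj_on \<phi> S"
    and h: "h \<in> borel_measurable borel" and nonneg: "\<And>z. 0 \<le> h z"
  shows "(\<integral>\<^sup>+z\<in>\<phi> ` S. ennreal (h z) \<partial>lborel)
       = (\<integral>\<^sup>+z\<in>S. ennreal (h (\<phi> z) * (norm (deriv \<phi> z))\<^sup>2) \<partial>lborel)"
proof -
  define S' where "S' = complex_of_vec -` S"
  define \<psi> where "\<psi> x = vec_of_complex (\<phi> (complex_of_vec x))" for x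
  define d where "d x = (\<lambda>y. vec_of_complex (deriv \<phi> (complex_of_vec x) * complex_of_vec y))" for x
  have S': "open S'"
    unfolding S'_def by (intro open_vimage S linear_continuous_on bounded_linear_complex_of_vec)
  have img: "\<psi> ` S' = complex_of_vec -` (\<phi> ` S)"
  proof safe
    fix x z assume "complex_of_vec x = \<phi> z" "z \<in> S"
    then have "x = \<psi> (vec_of_complex z)" "vec_of_complex z \<in> S'"
      by (auto simp: \<psi>_def S'_def) (metis complex_of_vec_inverse)
    then show "x \<in> \<psi> ` S'" by blast
  qed (auto simp: \<psi>_def S'_def)
  have opn: "open (\<phi> ` S)"
    using open_mapping_thm3[OF hol S inj] .
  have [measurable]: "S \<in> sets borel" "\<phi> ` S \<in> sets borel" "S' \<in> sets borel"
    using S opn S' by auto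
  \<comment> \<open>Only the values of \<phi> and \<open>deriv \<phi>\<close> on \<open>S\<close>
    are controlled. Cutting both off by the indicator of \<open>S\<close> gives Borel functions on
    the whole plane, whose product agrees with the cut-off integrand.\<close>
  have "(\<lambda>z. indicator S z *\<^sub>R \<phi> z) \<in> borel_measurable borel"
    using hol by (intro borel_measurable_continuous_on_indicator holomorphic_on_imp_continuous_on) auto
  then have m\<phi>: "(\<lambda>z. indicator S z *\<^sub>R h (indicator S z *\<^sub>R \<phi> z)) \<in> borel_measurable borel"
    using h by measurable
  have md: "(\<lambda>z. indicator S z *\<^sub>R deriv \<phi> z) \<in> borel_measurable borel"
    by (intro borel_measurable_continuous_on_indicator holomorphic_on_imp_continuous_on holomorphic_deriv hol S) auto
  have "(\<lambda>z. (indicator S z *\<^sub>R h (indicator S z *\<^sub>R \<phi> z)) * (norm (indicator S z *\<^sub>R deriv \<phi> z))\<^sup>2) \<in> borel_measurable borel"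
    using m\<phi> md by measurable
  also have "?this \<longleftrightarrow> (\<lambda>z. h (\<phi> z) * (norm (deriv \<phi> z))\<^sup>2 * indicator S z) \<in> borel_measurable borel"
    by (intro arg_cong[where f="\<lambda>f. f \<in> borel_measurable borel"] ext) (auto simp: indicator_def)
  finally have m1: "(\<lambda>z. h (\<phi> z) * (norm (deriv \<phi> z))\<^sup>2 * indicator S z) \<in> borel_measurable borel" .
  have m2: "(\<lambda>x. h (complex_of_vec x) * indicator (\<psi> ` S') x) \<in> borel_measurable borel"
    unfolding img indicator_vimage using h by measurable
  have "(\<lambda>x. (\<lambda>z. h (\<phi> z) * (norm (deriv \<phi> z))\<^sup>2 * indicator S z) (complex_of_vec x)) \<in> borel_measurable borel"
    by (rule measurable_compose[OF borel_measurable_complex_of_vec m1])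
  then have m3: "(\<lambda>x. (h (\<phi> (complex_of_vec x)) * (norm (deriv \<phi> (complex_of_vec x)))\<^sup>2) * indicator S' x) \<in> borel_measurable borel"
    unfolding S'_def indicator_vimage by simp
  have tr: "(\<integral>\<^sup>+z\<in>A. ennreal (F z) \<partial>lborel) = (\<integral>\<^sup>+x\<in>complex_of_vec -` A. ennreal (F (complex_of_vec x)) \<partial>lborel)"
    if "(\<lambda>z. F z * indicator A z) \<in> borel_measurable borel" for F A
  proof -
    have eq: "ennreal (F z) * indicator A z = ennreal (F z * indicator A z)" for z
      by (auto simp: indicator_def)
    show ?thesis
      unfolding eq using that
      by (subst distr_complex_of_vec[symmetric], subst nn_integral_distr)
         (auto intro!: nn_integral_cong simp: indicator_def)
  qed
  have L: "(\<integral>\<^sup>+z\<in>\<phi> ` S. ennreal (h z) \<partial>lborel) = (\<integral>\<^sup>+x\<in>\<psi> ` S'. ennreal (h (complex_of_vec x)) \<partial>lborel)"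
    unfolding img by (rule tr) (use h in measurable)
  have R: "(\<integral>\<^sup>+z\<in>S. ennreal (h (\<phi> z) * (norm (deriv \<phi> z))\<^sup>2) \<partial>lborel) =
     (\<integral>\<^sup>+x\<in>S'. ennreal (h (\<phi> (complex_of_vec x)) * (norm (deriv \<phi> (complex_of_vec x)))\<^sup>2) \<partial>lborel)"
    unfolding S'_def by (rule tr[OF m1])
  have der: "(\<psi> has_derivative d x) (at x within S')" if "x \<in> S'" for x
  proof -
    have "(\<phi> has_derivative (*) (deriv \<phi> (complex_of_vec x))) (at (complex_of_vec x))"
      using holomorphic_derivI[OF hol S, of "complex_of_vec x"] that
      by (auto simp: S'_def has_field_derivative_def)
    then have "((\<phi> \<circ> complex_of_vec) has_derivative ((*) (deriv \<phi> (complex_of_vec x)) \<circ> complex_of_vec)) (at x)"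
      by (intro diff_chain_at bounded_linear_imp_has_derivative bounded_linear_complex_of_vec)
    then have "((\<lambda>y. vec_of_complex ((\<phi> \<circ> complex_of_vec) y)) has_derivative
        (\<lambda>y. vec_of_complex (((*) (deriv \<phi> (complex_of_vec x)) \<circ> complex_of_vec) y))) (at x)"
      by (rule bounded_linear.has_derivative[OF bounded_linear_vec_of_complex])
    then show ?thesis
      unfolding \<psi>_def d_def by (auto simp: o_def intro: has_derivative_at_withinI)
  qed
  have injS: "inj_on \<psi> S'"
    using inj by (auto simp: inj_on_def \<psi>_def S'_def) (metis complex_of_vec_inverse vec_of_complex_inverse)
  have det: "\<bar>det (matrix (d x))\<bar> = (norm (deriv \<phi> (complex_of_vec x)))\<^sup>2" for x
    unfolding d_def det_matrix_complex_mult by simp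
  have key: "(\<integral>\<^sup>+z\<in>\<phi> ` S. ennreal (h z) \<partial>lborel) = ennreal b \<longleftrightarrow>
     (\<integral>\<^sup>+z\<in>S. ennreal (h (\<phi> z) * (norm (deriv \<phi> z))\<^sup>2) \<partial>lborel) = ennreal b" if "b \<ge> 0" for b
  proof -
    have "(\<integral>\<^sup>+z\<in>\<phi> ` S. ennreal (h z) \<partial>lborel) = ennreal b \<longleftrightarrow>
       (\<lambda>x. h (complex_of_vec x)) absolutely_integrable_on \<psi> ` S' \<and>
       integral (\<psi> ` S') (\<lambda>x. h (complex_of_vec x)) = b"
      unfolding L by (rule nn_integral_eq_iff_absolutely_integrable[OF m2]) (use nonneg that in auto)
    also have "\<dots> \<longleftrightarrow> (\<lambda>x. vec (h (complex_of_vec x)) :: real^1) absolutely_integrable_on \<psi> ` S' \<and>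
       integral (\<psi> ` S') (\<lambda>x. vec (h (complex_of_vec x)) :: real^1) = vec b"
      by (rule absolutely_integrable_vec1_iff[symmetric])
    also have "\<dots> \<longleftrightarrow> (\<lambda>x. \<bar>det (matrix (d x))\<bar> *\<^sub>R (vec (h (complex_of_vec (\<psi> x))) :: real^1)) absolutely_integrable_on S' \<and>
       integral S' (\<lambda>x. \<bar>det (matrix (d x))\<bar> *\<^sub>R (vec (h (complex_of_vec (\<psi> x))) :: real^1)) = vec b"
      by (rule has_absolute_integral_change_of_variables[symmetric])
         (use S' der injS in auto)
    also have "(\<lambda>x. \<bar>det (matrix (d x))\<bar> *\<^sub>R (vec (h (complex_of_vec (\<psi> x))) :: real^1)) =
       (\<lambda>x. vec (h (\<phi> (complex_of_vec x)) * (norm (deriv \<phi> (complex_of_vec x)))\<^sup>2))"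
      by (intro ext) (auto simp: det \<psi>_def vec_eq_iff)
    also have "((\<lambda>x. vec (h (\<phi> (complex_of_vec x)) * (norm (deriv \<phi> (complex_of_vec x)))\<^sup>2) :: real^1) absolutely_integrable_on S' \<and>
       integral S' (\<lambda>x. vec (h (\<phi> (complex_of_vec x)) * (norm (deriv \<phi> (complex_of_vec x)))\<^sup>2) :: real^1) = vec b)
     \<longleftrightarrow> (\<integral>\<^sup>+z\<in>S. ennreal (h (\<phi> z) * (norm (deriv \<phi> z))\<^sup>2) \<partial>lborel) = ennreal b"
      unfolding R absolutely_integrable_vec1_iff
      by (rule nn_integral_eq_iff_absolutely_integrable[symmetric, OF m3]) (use nonneg that in auto)
    finally show ?thesis .
  qed
  show ?thesis
    by (rule ennreal_eqI_real) (rule key)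
qed

section \<open>Radial integrals over the unit disc\<close>

lemma borel_measurable_indicator_ball [measurable]:
  "(indicator (ball c r) :: 'a::metric_space \<Rightarrow> ennreal) \<in> borel_measurable borel"
  by (intro borel_measurable_indicator) auto

text \<open>The disc of radius \<open>sqrt x\<close> has area \<open>pi * x\<close>, so the part of
  the unit disc with \<open>x < (norm z)^2\<close> has area \<open>pi * (1 - x)\<close>: the squared
  modulus is uniformly distributed. The measures are compared on the rays
  \<open>{x<..}\<close>.\<close>

lemma distr_norm_squared_unit_disc:
  "distr (density lborel (indicator (ball 0 1))) borel (\<lambda>z::complex. (norm z)\<^sup>2)
   = density lborel (\<lambda>t::real. ennreal pi * indicator {0..1} t)" (is "?M = ?N")
proof (rule measure_eqI_lessThan)
  have M: "emeasure ?M {x<..} = ennreal (pi * (if x < 0 then 1 else if x < 1 then 1 - x else 0))" for x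
  proof -
    have "emeasure ?M {x<..} = emeasure (density lborel (indicator (ball 0 1))) {z::complex. x < (norm z)\<^sup>2}"
      by (subst emeasure_distr) (auto intro!: arg_cong2[where f=emeasure])
    also have "\<dots> = emeasure lborel ({z::complex. x < (norm z)\<^sup>2} \<inter> ball 0 1)"
      by (subst emeasure_density)
         (auto intro!: nn_integral_cong simp: indicator_def simp flip: nn_integral_indicator)
    also have "\<dots> = ennreal (pi * (if x < 0 then 1 else if x < 1 then 1 - x else 0))"
    proof -
      consider "x < 0" | "0 \<le> x" "x < 1" | "1 \<le> x" by linarith
      then show ?thesis
      proof cases
        case 1
        then have "{z::complex. x < (norm z)\<^sup>2} \<inter> ball 0 1 = ball 0 1"
          by (auto intro: less_le_trans)
        then show ?thesis using 1 by (simp add: emeasure_ball unit_ball_vol_2)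
      next
        case 2
        have "{z::complex. x < (norm z)\<^sup>2} \<inter> ball 0 1 = ball 0 1 - cball 0 (sqrt x)"
          using 2 real_less_rsqrt real_less_lsqrt by (auto simp: not_le power2_eq_square intro: real_le_rsqrt)
             (metis not_le real_sqrt_less_iff real_sqrt_abs abs_norm_cancel power2_eq_square)+
        moreover have "cball 0 (sqrt x) \<subseteq> (ball 0 1 :: complex set)"
          using 2 by auto (metis le_less_trans real_sqrt_lt_1_iff)
        ultimately have "emeasure lborel ({z::complex. x < (norm z)\<^sup>2} \<inter> ball 0 1) =
           emeasure lborel (ball 0 1 :: complex set) - emeasure lborel (cball 0 (sqrt x) :: complex set)"
          using 2 by (simp add: emeasure_Diff emeasure_cball)
        also have "\<dots> = ennreal (pi * (1 - x))"
          using 2 by (simp add: emeasure_ball emeasure_cball unit_ball_vol_2 ennreal_minus algebra_simps)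
        finally show ?thesis using 2 by simp
      next
        case 3
        have "(norm z)\<^sup>2 < 1" if "norm z < 1" for z :: complex
          using that by (simp add: power_less_one_iff)
        with 3 have "{z::complex. x < (norm z)\<^sup>2} \<inter> ball 0 1 = {}"
          by (force simp: not_less)
        then show ?thesis using 3 by simp
      qed
    qed
    finally show ?thesis .
  qed
  have N: "emeasure ?N {x<..} = ennreal (pi * (if x < 0 then 1 else if x < 1 then 1 - x else 0))" for x
  proof -
    have "emeasure ?N {x<..} = (\<integral>\<^sup>+t. ennreal pi * indicator ({0..1} \<inter> {x<..}) t \<partial>lborel)"
      by (subst emeasure_density) (auto intro!: nn_integral_cong simp: indicator_def)
    also have "\<dots> = ennreal pi * emeasure lborel ({0..1} \<inter> {x<..})"
      by (subst nn_integral_cmult_indicator) auto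
    also have "{0..1} \<inter> {x<..} = (if x < 0 then {0..1} else {x<..1})"
      by auto
    also have "ennreal pi * emeasure lborel \<dots> = ennreal (pi * (if x < 0 then 1 else if x < 1 then 1 - x else 0))"
      by (auto simp: ennreal_mult)
    finally show ?thesis .
  qed
  show "emeasure ?M {x<..} = emeasure ?N {x<..}" for x
    by (simp only: M N)
  show "emeasure ?M {x<..} < \<infinity>" for x
    by (simp only: M) simp
qed auto

text \<open>Polar coordinates with \<open>t = (norm z)^2\<close> as the variable, which absorbs the
  factor \<open>2 * r\<close> of the area element.\<close>

lemma nn_integral_radial_unit_disc:
  assumes [measurable]: "h \<in> borel_measurable borel"
  shows "(\<integral>\<^sup>+z\<in>ball 0 1. h ((norm (z::complex))\<^sup>2) \<partial>lborel) = ennreal pi * (\<integral>\<^sup>+t\<in>{0..1}. h t \<partial>lborel)"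
proof -
  have "(\<integral>\<^sup>+z\<in>ball 0 1. h ((norm (z::complex))\<^sup>2) \<partial>lborel)
     = (\<integral>\<^sup>+t. h t \<partial>distr (density lborel (indicator (ball 0 1))) borel (\<lambda>z::complex. (norm z)\<^sup>2))"
    by (subst nn_integral_distr, simp_all, subst nn_integral_density) (auto simp: mult.commute)
  also have "\<dots> = (\<integral>\<^sup>+t. ennreal pi * (h t * indicator {0..1} t) \<partial>lborel)"
    unfolding distr_norm_squared_unit_disc
    by (simp add: nn_integral_density mult_ac)
  also have "\<dots> = ennreal pi * (\<integral>\<^sup>+t\<in>{0..1}. h t \<partial>lborel)"
    by (subst nn_integral_cmult) auto
  finally show ?thesis .
qed

section \<open>The radial probability weight and its moments\<close>

definition bergman_weight :: "real \<Rightarrow> complex \<Rightarrow> real" where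
  "bergman_weight \<alpha> z = (\<alpha> + 1) * (1 - (norm z)\<^sup>2) powr \<alpha> / pi"

lemma borel_measurable_bergman_weight [measurable]: "bergman_weight \<alpha> \<in> borel_measurable borel"
  unfolding bergman_weight_def by measurable

text \<open>In the variable \<open>t = (norm z)^2\<close> this is
  \<open>(\<alpha> + 1) * Beta (q / 2 + 1) (\<alpha> + 1)\<close>, and the recurrence of
  \<open>Gamma\<close> absorbs the factor \<open>\<alpha> + 1\<close>. For \<open>q = N * p\<close>
  the value is the reciprocal of the constant in the theorem.\<close>

lemma nn_integral_norm_powr_bergman_weight:
  assumes "\<alpha> > -1" "q \<ge> 0"
  shows "(\<integral>\<^sup>+z\<in>ball 0 1. ennreal (norm z powr q * bergman_weight \<alpha> z) \<partial>lborel)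
       = ennreal (Gamma (2 + \<alpha>) * Gamma (q / 2 + 1) / Gamma (q / 2 + 2 + \<alpha>))"
proof -
  have "(\<integral>\<^sup>+z\<in>ball 0 1. ennreal (norm z powr q * bergman_weight \<alpha> z) \<partial>lborel)
      = (\<integral>\<^sup>+z\<in>ball 0 1. (\<lambda>t. ennreal ((\<alpha> + 1) / pi * (t powr (q / 2) * (1 - t) powr \<alpha>))) ((norm (z::complex))\<^sup>2) \<partial>lborel)"
  proof (intro nn_integral_cong)
    fix z :: complex
    have "norm z powr q = ((norm z)\<^sup>2) powr (q / 2)"
      by (cases "z = 0") (simp_all add: powr_powr flip: powr_numeral)
    then show "ennreal (norm z powr q * bergman_weight \<alpha> z) * indicator (ball 0 1) z =
      ennreal ((\<alpha> + 1) / pi * (((norm z)\<^sup>2) powr (q / 2) * (1 - (norm z)\<^sup>2) powr \<alpha>)) * indicator (ball 0 1) z"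
      by (simp add: bergman_weight_def mult_ac)
  qed
  also have "\<dots> = ennreal pi * (\<integral>\<^sup>+t\<in>{0..1}. ennreal ((\<alpha> + 1) / pi * (t powr (q / 2) * (1 - t) powr \<alpha>)) \<partial>lborel)"
    by (rule nn_integral_radial_unit_disc) measurable
  also have "(\<integral>\<^sup>+t\<in>{0..1}. ennreal ((\<alpha> + 1) / pi * (t powr (q / 2) * (1 - t) powr \<alpha>)) \<partial>lborel)
     = ennreal ((\<alpha> + 1) / pi * Beta (q / 2 + 1) (\<alpha> + 1))"
  proof (rule nn_integral_has_integral_lebesgue')
    show "((\<lambda>t. (\<alpha> + 1) / pi * (t powr (q / 2) * (1 - t) powr \<alpha>)) has_integral
       (\<alpha> + 1) / pi * Beta (q / 2 + 1) (\<alpha> + 1)) {0..1}"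
      using has_integral_mult_right[OF has_integral_Beta_real[of "q / 2 + 1" "\<alpha> + 1"], of "(\<alpha> + 1) / pi"] assms by simp
  qed (use assms in auto)
  also have "ennreal pi * \<dots> = ennreal ((\<alpha> + 1) * Beta (q / 2 + 1) (\<alpha> + 1))"
    using assms by (simp flip: ennreal_mult')
  also have "(\<alpha> + 1) * Beta (q / 2 + 1) (\<alpha> + 1) = Gamma (2 + \<alpha>) * Gamma (q / 2 + 1) / Gamma (q / 2 + 2 + \<alpha>)"
  proof -
    have "Gamma (2 + \<alpha>) = (\<alpha> + 1) * Gamma (\<alpha> + 1)"
      using Gamma_plus1[of "\<alpha> + 1"] assms by (simp add: add_ac nonpos_Ints_def)
    then show ?thesis by (simp add: Beta_def add_ac)
  qed
  finally show ?thesis .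
qed

lemma nn_integral_bergman_weight:
  assumes "\<alpha> > -1"
  shows "(\<integral>\<^sup>+z\<in>ball 0 1. ennreal (bergman_weight \<alpha> z) \<partial>lborel) = 1"
proof -
  have "(\<integral>\<^sup>+z\<in>ball 0 1. ennreal (bergman_weight \<alpha> z) \<partial>lborel)
     = (\<integral>\<^sup>+z\<in>ball 0 1. ennreal (norm z powr 0 * bergman_weight \<alpha> z) \<partial>lborel)"
    \<comment> \<open>Since \<open>0 powr 0 = 0\<close>, the moment with \<open>q = 0\<close> has
      the wrong integrand at the origin, which is a null set.\<close>
    using AE_lborel_singleton[of "0::complex"]
    by (intro nn_integral_cong_AE) (erule eventually_mono, simp)
  also have "Gamma (2 + \<alpha>) > 0"
    using assms by (intro Gamma_real_pos) auto
  then have "(\<integral>\<^sup>+z\<in>ball 0 1. ennreal (norm z powr 0 * bergman_weight \<alpha> z) \<partial>lborel) = 1"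
    using nn_integral_norm_powr_bergman_weight[OF assms, of 0] by simp
  finally show ?thesis .
qed

section \<open>Maximum principle for sums of powers of moduli\<close>

text \<open>
  Near a maximum point \<open>z\<close> the holomorphic function \<open>F = \<Sum>i. cnj (sgn (k i z)) * k i\<close>, with \<open>k i\<close> a branch
  of the \<open>p\<close>-th power of \<open>g i\<close>, is dominated in modulus by the sum and agrees with it at \<open>z\<close>, so the
  maximum modulus principle applies to \<open>F\<close>.
\<close>

lemma local_max_sum_norm_powr:
  fixes g :: "'i \<Rightarrow> complex \<Rightarrow> complex"
  assumes I: "finite I" and "open U" and hol: "\<And>i. i \<in> I \<Longrightarrow> g i holomorphic_on U" and p: "0 < p"
    and z: "z \<in> U" and max: "\<And>w. w \<in> U \<Longrightarrow> (\<Sum>i\<in>I. norm (g i w) powr p) \<le> (\<Sum>i\<in>I. norm (g i z) powr p)"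
  shows "\<exists>e>0. ball z e \<subseteq> U \<and> (\<forall>w\<in>ball z e. (\<Sum>i\<in>I. norm (g i w) powr p) = (\<Sum>i\<in>I. norm (g i z) powr p))"
proof -
  \<comment> \<open>A \<open>g i\<close> that vanishes at \<open>z\<close> need not have a logarithm
    nearby. Dropping these terms leaves the sum at \<open>z\<close> unchanged and can only lower it
    elsewhere, which is the direction needed.\<close>
  define J where "J = {i \<in> I. g i z \<noteq> 0}"
  have J: "finite J" "J \<subseteq> I" using I by (auto simp: J_def)
  have "eventually (\<lambda>w. \<forall>i\<in>J. g i w \<noteq> 0) (nhds z)"
  proof (intro eventually_ball_finite[OF J(1)] ballI)
    fix i assume i: "i \<in> J"
    have "isCont (g i) z"
      using holomorphic_on_imp_continuous_on[OF hol[of i]] i J z \<open>open U\<close>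
      by (auto simp: continuous_on_eq_continuous_at)
    then show "eventually (\<lambda>w. g i w \<noteq> 0) (nhds z)"
      using i by (auto simp: J_def isCont_def eventually_nhds_conv_at intro: tendsto_imp_eventually_ne)
  qed
  then have "eventually (\<lambda>w. w \<in> U \<and> (\<forall>i\<in>J. g i w \<noteq> 0)) (nhds z)"
    using \<open>open U\<close> z by (auto intro: eventually_conj eventually_nhds_in_open)
  then obtain e where e: "e > 0" "\<And>w. w \<in> ball z e \<Longrightarrow> w \<in> U \<and> (\<forall>i\<in>J. g i w \<noteq> 0)"
    by (auto simp: eventually_nhds_metric dist_commute)
  have "\<exists>k. k holomorphic_on ball z e \<and> (\<forall>w\<in>ball z e. norm (k w) = norm (g i w) powr p)" if i: "i \<in> J" for i
  proof -
    have "g i holomorphic_on ball z e"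
      using hol[of i] i J e by (meson holomorphic_on_subset subsetD subsetI)
    then obtain l where l: "l holomorphic_on ball z e" "\<And>w. w \<in> ball z e \<Longrightarrow> g i w = exp (l w)"
      using contractible_imp_holomorphic_log[of "g i" "ball z e"] e i
      by (metis convex_ball convex_imp_contractible)
    show ?thesis
      by (intro exI[of _ "\<lambda>w. exp (of_real p * l w)"] conjI ballI)
         (auto intro!: holomorphic_intros l simp: l powr_def)
  qed
  then obtain k where k: "\<And>i. i \<in> J \<Longrightarrow> k i holomorphic_on ball z e"
     "\<And>i w. i \<in> J \<Longrightarrow> w \<in> ball z e \<Longrightarrow> norm (k i w) = norm (g i w) powr p"
    by metis
  define F where "F w = (\<Sum>i\<in>J. cnj (sgn (k i z)) * k i w)" for w
  have vJ: "(\<Sum>i\<in>J. norm (g i w) powr p) \<le> (\<Sum>i\<in>I. norm (g i w) powr p)" for w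
    by (rule sum_mono2) (use I J in auto)
  have vJz: "(\<Sum>i\<in>J. norm (g i z) powr p) = (\<Sum>i\<in>I. norm (g i z) powr p)"
    by (rule sum.mono_neutral_left) (use I p in \<open>auto simp: J_def\<close>)
  have zz: "z \<in> ball z e" using e by simp
  have "F z = of_real (\<Sum>i\<in>J. norm (k i z))"
    unfolding F_def of_real_sum
  proof (intro sum.cong refl)
    fix i
    have "cnj (k i z) * k i z = of_real ((norm (k i z))\<^sup>2)"
      by (metis complex_norm_square mult.commute)
    then show "cnj (sgn (k i z)) * k i z = of_real (norm (k i z))"
      by (cases "k i z = 0") (simp_all add: sgn_eq field_simps power2_eq_square)
  qed
  then have Fz: "norm (F z) = (\<Sum>i\<in>I. norm (g i z) powr p)"
    using k(2)[OF _ zz] vJz by (simp add: sum_nonneg del: of_real_sum)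
  have Fle: "norm (F w) \<le> (\<Sum>i\<in>I. norm (g i w) powr p)" if "w \<in> ball z e" for w
  proof -
    have "norm (F w) \<le> (\<Sum>i\<in>J. norm (cnj (sgn (k i z)) * k i w))"
      unfolding F_def by (rule norm_sum)
    also have "\<dots> \<le> (\<Sum>i\<in>J. norm (g i w) powr p)"
      by (intro sum_mono) (auto simp: norm_mult norm_sgn k(2)[OF _ that])
    finally show ?thesis using vJ[of w] by simp
  qed
  have "F constant_on ball z e"
  proof (rule maximum_modulus_principle[of _ _ "ball z e" z])
    show "F holomorphic_on ball z e"
      unfolding F_def by (intro holomorphic_intros k)
    show "norm (F w) \<le> norm (F z)" if "w \<in> ball z e" for w
      using Fle[OF that] max[of w] e(2)[OF that] Fz by simp
  qed (use e in auto)
  then have "F w = F z" if "w \<in> ball z e" for w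
    using that zz unfolding constant_on_def by metis
  then have "(\<Sum>i\<in>I. norm (g i w) powr p) = (\<Sum>i\<in>I. norm (g i z) powr p)" if "w \<in> ball z e" for w
    using Fle[OF that] Fz max[of w] e(2)[OF that] that by simp
  moreover have "ball z e \<subseteq> U"
    using e(2) by blast
  ultimately show ?thesis
    using e(1) by blast
qed

text \<open>The set where the sum equals its maximum over the closed ball is closed in the open ball
  by continuity and open by the local result. If a maximum point lies inside, connectedness makes
  the sum constant, up to the sphere by continuity.\<close>

lemma sum_norm_powr_max_on_sphere:
  fixes g :: "'i \<Rightarrow> complex \<Rightarrow> complex"
  assumes I: "finite I" and hol: "\<And>i. i \<in> I \<Longrightarrow> g i holomorphic_on ball c R"
    and cont: "\<And>i. i \<in> I \<Longrightarrow> continuous_on (cball c R) (g i)"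
    and p: "0 < p" and z: "z \<in> cball c R"
  shows "\<exists>w\<in>sphere c R. (\<Sum>i\<in>I. norm (g i z) powr p) \<le> (\<Sum>i\<in>I. norm (g i w) powr p)"
proof -
  define v where "v w = (\<Sum>i\<in>I. norm (g i w) powr p)" for w
  have contv: "continuous_on (cball c R) v"
    unfolding v_def using p by (intro continuous_intros cont continuous_on_powr') auto
  obtain x where x: "x \<in> cball c R" "\<And>w. w \<in> cball c R \<Longrightarrow> v w \<le> v x"
    using continuous_attains_sup[OF compact_cball _ contv] z by blast
  show ?thesis
  proof (cases "x \<in> sphere c R")
    case True
    then show ?thesis using x(2)[OF z] unfolding v_def by blast
  next
    case False
    then have xb: "x \<in> ball c R" using x by auto
    then have R: "R > 0" by (meson le_less_trans mem_ball zero_le_dist)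
    define S where "S = {w \<in> ball c R. v w = v x}"
    have "open S"
      unfolding open_contains_ball
    proof
      fix w assume w: "w \<in> S"
      have "w \<in> ball c R" and vw: "v w = v x"
        using w by (auto simp: S_def)
      moreover have "v y \<le> v w" if "y \<in> ball c R" for y
        using x(2)[of y] that vw by simp
      ultimately obtain e where e: "e > 0" "ball w e \<subseteq> ball c R" "\<And>y. y \<in> ball w e \<Longrightarrow> v y = v w"
        using local_max_sum_norm_powr[of I "ball c R" g p w] I hol p unfolding v_def by auto
      have "ball w e \<subseteq> S"
      proof
        fix y assume "y \<in> ball w e"
        then show "y \<in> S" using e(2) e(3)[of y] vw by (simp only: S_def) blast
      qed
      with e(1) show "\<exists>e>0. ball w e \<subseteq> S"
        by blast
    qed
    then have "openin (top_of_set (ball c R)) S"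
      by (auto simp: openin_open_eq S_def)
    moreover have "closedin (top_of_set (ball c R)) S"
      unfolding S_def
      by (rule continuous_closedin_preimage_constant) (use contv ball_subset_cball continuous_on_subset in blast)
    ultimately have "S = ball c R"
      using connected_ball[of c R] xb unfolding connected_clopen S_def by blast
    then have vS: "v y = v x" if "y \<in> ball c R" for y
      using that unfolding S_def by blast
    have cl: "closure (ball c R) = cball c R"
      using R by simp
    have "v w = v x" if "w \<in> cball c R" for w
      by (rule continuous_constant_on_closure[of "ball c R"]) (use contv that cl vS in simp_all)
    moreover have "c + of_real R \<in> sphere c R"
      using R by (simp add: dist_norm)
    moreover have "c + of_real R \<in> cball c R"
      using R by (simp add: dist_norm)
    ultimately have "c + of_real R \<in> sphere c R" "v z = v (c + of_real R)"
      using z by simp_all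
    then show ?thesis
      unfolding v_def by (intro bexI[of _ "c + of_real R"]) simp_all
  qed
qed

section \<open>Averages over roots of unity\<close>

lemma holomorphic_on_mult_left_ball:
  fixes \<omega> :: complex
  assumes "g holomorphic_on ball 0 r" "norm \<omega> = 1" "s \<le> r"
  shows "(\<lambda>z. g (\<omega> * z)) holomorphic_on ball 0 s"
proof -
  have "(g \<circ> (*) \<omega>) holomorphic_on ball 0 s"
    by (rule holomorphic_on_compose_gen[OF _ assms(1)])
       (use assms in \<open>auto intro!: holomorphic_intros simp: norm_mult\<close>)
  then show ?thesis by (simp add: o_def)
qed

text \<open>The argument \<open>t\<close> of \<zeta> is rounded down to a multiple of
  \<open>2 * pi / n\<close>; a chord is at most as long as its arc.\<close>

lemma root_of_unity_near:
  assumes "n \<ge> 1" "norm (\<zeta> :: complex) = 1"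
  obtains \<omega> where "\<omega> ^ n = 1" "norm (\<zeta> - \<omega>) \<le> 2 * pi / real n"
proof -
  obtain t where t: "0 \<le> t" "\<zeta> = exp (\<i> * of_real t)"
    using Arg2pi[of \<zeta>] assms by (auto simp: is_Arg_def)
  define k where "k = nat \<lfloor>t * real n / (2 * pi)\<rfloor>"
  define s where "s = 2 * pi * real k / real n"
  have k: "real k \<le> t * real n / (2 * pi)" "t * real n / (2 * pi) \<le> real k + 1"
    using t by (auto simp: k_def)
  have "s \<le> t"
    using k(1) assms by (simp add: s_def field_simps)
  moreover have "t \<le> s + 2 * pi / real n"
    using k(2) assms by (simp add: s_def field_simps)
  ultimately have ts: "\<bar>t - s\<bar> \<le> 2 * pi / real n"
    by simp
  show ?thesis
  proof
    have "exp (\<i> * of_real s) ^ n = exp (\<i> * of_real (2 * pi * real k))"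
      using assms by (simp add: s_def flip: exp_of_nat_mult)
    also have "\<dots> = 1"
      by (subst exp_eq_1) (auto intro!: exI[of _ "int k"])
    finally show "exp (\<i> * of_real s) ^ n = 1" .
    have "\<zeta> - exp (\<i> * of_real s) = exp (\<i> * of_real s) * (exp (\<i> * of_real (t - s)) - 1)"
      by (simp add: t algebra_simps flip: exp_add)
    then have "norm (\<zeta> - exp (\<i> * of_real s)) = 2 * \<bar>sin ((t - s) / 2)\<bar>"
      by (simp add: norm_mult dist_exp_i_1 del: of_real_diff)
    also have "\<dots> \<le> \<bar>t - s\<bar>"
      using abs_sin_x_le_abs_x[of "(t - s) / 2"] by simp
    finally show "norm (\<zeta> - exp (\<i> * of_real s)) \<le> 2 * pi / real n"
      using ts by linarith
  qed
qed

lemma roots_of_unity_mult_image: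
  assumes "n \<ge> 1" "(\<omega>::complex) ^ n = 1"
  shows "bij_betw ((*) \<omega>) {\<zeta>. \<zeta> ^ n = 1} {\<zeta>. \<zeta> ^ n = 1}"
proof -
  have "\<omega> \<noteq> 0" using assms by (auto simp: power_0_left)
  then show ?thesis
    using assms by (intro bij_betwI[of _ _ _ "\<lambda>z. z / \<omega>"]) (auto simp: power_mult_distrib power_divide)
qed

lemma norm_root_of_unity:
  assumes "n \<ge> 1" "(\<omega>::complex) ^ n = 1"
  shows "norm \<omega> = 1"
  using power_eq_1_iff[OF assms(2)] assms by auto

text \<open>The maximum principle yields a point \<open>w'\<close> on the circle of radius
  \<open>R\<close> whose sum is at least that of \<open>z\<close>. Some root of unity rotates
  \<open>w\<close> close to \<open>w'\<close>; this rotation only permutes the terms of the sum, and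
  uniform continuity bounds the error by \<epsilon> per term. The number \<open>n\<close> does not
  depend on \<open>z\<close> and \<open>w\<close>, so the inequality can later be integrated over
  directions.\<close>

lemma root_average_almost_mono:
  fixes g :: "complex \<Rightarrow> complex"
  assumes hol: "g holomorphic_on ball 0 1" and p: "0 < p" and "R < 1" "0 < \<epsilon>"
  shows "\<exists>n\<ge>1. \<forall>z w. norm z \<le> norm w \<and> norm w = R \<longrightarrow>
    (\<Sum>\<omega> | \<omega> ^ n = 1. norm (g (\<omega> * z)) powr p) \<le> (\<Sum>\<omega> | \<omega> ^ n = 1. norm (g (\<omega> * w)) powr p) + real n * \<epsilon>"
proof (cases "R \<ge> 0")
  case True
  have cont: "continuous_on (cball 0 R) (\<lambda>z. norm (g z) powr p)"
    using holomorphic_on_imp_continuous_on[OF hol] p \<open>R < 1\<close>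
    by (intro continuous_intros continuous_on_powr') (auto elim!: continuous_on_subset)
  then have "uniformly_continuous_on (cball 0 R) (\<lambda>z. norm (g z) powr p)"
    by (rule compact_uniformly_continuous) simp
  then obtain \<delta> where "\<delta> > 0" and \<delta>: "\<And>x y. norm x \<le> R \<Longrightarrow> norm y \<le> R \<Longrightarrow> dist y x < \<delta> \<Longrightarrow>
      dist (norm (g y) powr p) (norm (g x) powr p) < \<epsilon>"
    using \<open>\<epsilon> > 0\<close> unfolding uniformly_continuous_on_def by (metis mem_cball_0)
  \<comment> \<open>With this \<open>n\<close> every point of the unit circle has an
    \<open>n\<close>-th root of unity at distance less than \<delta>.\<close>
  obtain n :: nat where n: "2 * pi / \<delta> < real n" "n \<ge> 1"
    by (metis reals_Archimedean2 less_eq_nat.simps(1) linorder_not_le less_one max.cobounded1 max.strict_coboundedI2 of_nat_max)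
  have n\<delta>: "2 * pi / real n < \<delta>"
    using n \<open>\<delta> > 0\<close> by (simp add: field_simps)
  have fin: "finite {\<omega>::complex. \<omega> ^ n = 1}" and card: "card {\<omega>::complex. \<omega> ^ n = 1} = n"
    using n by (auto simp: finite_roots_unity card_complex_roots_unity)
  show ?thesis
  proof (intro exI[of _ n] conjI allI impI n(2))
    fix z w :: complex assume zw: "norm z \<le> norm w \<and> norm w = R"
    have "\<exists>w'\<in>sphere 0 R. (\<Sum>\<omega> | \<omega> ^ n = 1. norm (g (\<omega> * z)) powr p) \<le> (\<Sum>\<omega> | \<omega> ^ n = 1. norm (g (\<omega> * w')) powr p)"
    proof (rule sum_norm_powr_max_on_sphere[OF fin _ _ p])
      fix \<omega> :: complex assume "\<omega> \<in> {\<omega>. \<omega> ^ n = 1}"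
      then have \<omega>: "norm \<omega> = 1" using norm_root_of_unity n by blast
      show "(\<lambda>z. g (\<omega> * z)) holomorphic_on ball 0 R"
        by (rule holomorphic_on_mult_left_ball[OF hol \<omega>]) (use \<open>R < 1\<close> in simp)
      have "(\<lambda>z. g (\<omega> * z)) holomorphic_on ball 0 1"
        by (rule holomorphic_on_mult_left_ball[OF hol \<omega>]) simp
      then show "continuous_on (cball 0 R) (\<lambda>z. g (\<omega> * z))"
        using \<open>R < 1\<close> by (auto intro!: holomorphic_on_imp_continuous_on elim!: holomorphic_on_subset)
    qed (use zw in auto)
    then obtain w' where w': "norm w' = R"
      "(\<Sum>\<omega> | \<omega> ^ n = 1. norm (g (\<omega> * z)) powr p) \<le> (\<Sum>\<omega> | \<omega> ^ n = 1. norm (g (\<omega> * w')) powr p)"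
      by auto
    \<comment> \<open>The root approximates the quotient \<open>w' / w\<close>; for
      \<open>R = 0\<close> both points are the origin.\<close>
    obtain \<omega>0 where \<omega>0: "\<omega>0 ^ n = 1" "norm (w' - \<omega>0 * w) < \<delta>"
    proof (cases "R = 0")
      case True
      then show ?thesis using that[of 1] w' zw \<open>\<delta> > 0\<close> by simp
    next
      case False
      then have "norm (w' / w) = 1" using w' zw by (simp add: norm_divide)
      then obtain \<omega> where \<omega>: "\<omega> ^ n = 1" "norm (w' / w - \<omega>) \<le> 2 * pi / real n"
        using root_of_unity_near n(2) by blast
      have "w' - \<omega> * w = (w' / w - \<omega>) * w"
        using False zw by (auto simp: field_simps)
      then have "norm (w' - \<omega> * w) = norm (w' / w - \<omega>) * R"
        using zw by (simp add: norm_mult)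
      also have "\<dots> \<le> norm (w' / w - \<omega>) * 1"
        using \<open>R < 1\<close> True by (intro mult_left_mono) auto
      finally show ?thesis using \<omega> n\<delta> that by force
    qed
    have "(\<Sum>\<omega> | \<omega> ^ n = 1. norm (g (\<omega> * w')) powr p) \<le> (\<Sum>\<omega> | \<omega> ^ n = 1. norm (g (\<omega> * (\<omega>0 * w))) powr p + \<epsilon>)"
    proof (rule sum_mono)
      fix \<omega> :: complex assume "\<omega> \<in> {\<omega>. \<omega> ^ n = 1}"
      then have \<omega>: "norm \<omega> = 1" using norm_root_of_unity n by blast
      have 1: "norm \<omega>0 = 1" using norm_root_of_unity n \<omega>0 by blast
      have "dist (\<omega> * w') (\<omega> * (\<omega>0 * w)) < \<delta>"
        using \<omega>0 \<omega> by (simp add: dist_norm norm_mult flip: right_diff_distrib)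
      then have "dist (norm (g (\<omega> * w')) powr p) (norm (g (\<omega> * (\<omega>0 * w))) powr p) < \<epsilon>"
        by (intro \<delta>) (use \<omega> 1 w' zw in \<open>auto simp: norm_mult\<close>)
      then show "norm (g (\<omega> * w')) powr p \<le> norm (g (\<omega> * (\<omega>0 * w))) powr p + \<epsilon>"
        by (simp add: dist_real_def)
    qed
    also have "\<dots> = (\<Sum>\<omega> | \<omega> ^ n = 1. norm (g ((\<omega>0 * \<omega>) * w)) powr p) + real n * \<epsilon>"
      by (simp add: sum.distrib card mult_ac)
    also have "(\<Sum>\<omega> | \<omega> ^ n = 1. norm (g ((\<omega>0 * \<omega>) * w)) powr p) = (\<Sum>\<omega> | \<omega> ^ n = 1. norm (g (\<omega> * w)) powr p)"
      by (rule sum.reindex_bij_betw[OF roots_of_unity_mult_image[OF n(2) \<omega>0(1)]])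
    finally show "(\<Sum>\<omega> | \<omega> ^ n = 1. norm (g (\<omega> * z)) powr p)
        \<le> (\<Sum>\<omega> | \<omega> ^ n = 1. norm (g (\<omega> * w)) powr p) + real n * \<epsilon>"
      using w' by simp
  qed
\<comment> \<open>For \<open>R < 0\<close> no \<open>w\<close> has norm \<open>R\<close>, so any
  positive \<open>n\<close> will do.\<close>
qed (auto intro!: exI[of _ "1::nat"])

section \<open>Rotation invariance of area integrals\<close>

lemma nn_integral_rotate:
  fixes h :: "complex \<Rightarrow> real"
  assumes "h \<in> borel_measurable borel" "\<And>z. 0 \<le> h z" "open S" "norm \<sigma> = 1" "(*) \<sigma> ` S = S"
  shows "(\<integral>\<^sup>+z\<in>S. ennreal (h (\<sigma> * z)) \<partial>lborel) = (\<integral>\<^sup>+z\<in>S. ennreal (h z) \<partial>lborel)"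
proof -
  have "(\<integral>\<^sup>+z\<in>(*) \<sigma> ` S. ennreal (h z) \<partial>lborel) = (\<integral>\<^sup>+z\<in>S. ennreal (h (\<sigma> * z) * (norm (deriv ((*) \<sigma>) z))\<^sup>2) \<partial>lborel)"
    by (rule nn_integral_holomorphic_substitution)
       (use assms in \<open>auto intro!: holomorphic_intros inj_onI\<close>)
  then show ?thesis using assms by simp
qed

lemma rotate_image_ball:
  assumes "norm (\<sigma>::complex) = 1"
  shows "(*) \<sigma> ` ball 0 r = ball 0 r" "(*) \<sigma> ` (ball 0 r - {0}) = ball 0 r - {0}"
proof -
  have "\<sigma> \<noteq> 0" using assms by auto
  have *: "z = \<sigma> * (z / \<sigma>)" "norm (z / \<sigma>) = norm z" for z
    using assms \<open>\<sigma> \<noteq> 0\<close> by (auto simp: norm_divide)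
  show "(*) \<sigma> ` ball 0 r = ball 0 r"
  proof safe
    fix z :: complex assume "z \<in> ball 0 r"
    then have "z / \<sigma> \<in> ball 0 r" using * by simp
    then show "z \<in> (*) \<sigma> ` ball 0 r" using *(1) by blast
  qed (use assms in \<open>simp add: norm_mult\<close>)
  moreover have "inj ((*) \<sigma>)" using \<open>\<sigma> \<noteq> 0\<close> by (auto intro: injI)
  ultimately show "(*) \<sigma> ` (ball 0 r - {0}) = ball 0 r - {0}"
    by (simp add: image_set_diff)
qed

section \<open>Circular means\<close>

text \<open>
  A multiple of the mean over the circle through \<open>z\<close>: averaging over directions \<open>sgn \<xi>\<close> of points of the
  disc makes rotation invariance an instance of the substitution rule.
\<close>

definition circ_mean :: "(complex \<Rightarrow> real) \<Rightarrow> complex \<Rightarrow> ennreal" where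
  "circ_mean u z = (\<integral>\<^sup>+\<xi>\<in>ball 0 1 - {0}. ennreal (u (z * sgn \<xi>)) \<partial>lborel)"

lemma borel_measurable_indicator_punctured_ball [measurable]:
  "(indicator (ball c r - {c}) :: 'a::metric_space \<Rightarrow> ennreal) \<in> borel_measurable borel"
  by (intro borel_measurable_indicator) auto

lemma borel_measurable_sgn_complex [measurable]: "(sgn :: complex \<Rightarrow> complex) \<in> borel_measurable borel"
  unfolding sgn_div_norm by measurable

lemma emeasure_punctured_disc: "emeasure lborel (ball 0 1 - {0} :: complex set) = ennreal pi"
  by (subst emeasure_Diff) (auto simp: emeasure_ball unit_ball_vol_2)

lemma borel_measurable_circ_mean [measurable]:
  assumes [measurable]: "u \<in> borel_measurable borel"
  shows "circ_mean u \<in> borel_measurable borel"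
  unfolding circ_mean_def by measurable

lemma circ_mean_rotate:
  assumes [measurable]: "u \<in> borel_measurable borel" and "\<And>z. 0 \<le> u z" and "norm \<omega> = 1"
  shows "(\<integral>\<^sup>+\<xi>\<in>ball 0 1 - {0}. ennreal (u (\<omega> * (z * sgn \<xi>))) \<partial>lborel) = circ_mean u z"
proof -
  have "(\<integral>\<^sup>+\<xi>\<in>ball 0 1 - {0}. ennreal (u (\<omega> * (z * sgn \<xi>))) \<partial>lborel)
     = (\<integral>\<^sup>+\<xi>\<in>ball 0 1 - {0}. ennreal ((\<lambda>\<xi>. u (z * sgn \<xi>)) (\<omega> * \<xi>)) \<partial>lborel)"
  proof -
    have "sgn (\<omega> * \<xi>) = \<omega> * sgn \<xi>" for \<xi>
      using assms(3) by (simp add: sgn_mult) (simp add: sgn_eq)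
    then show ?thesis by (simp add: mult_ac)
  qed
  also have "\<dots> = (\<integral>\<^sup>+\<xi>\<in>ball 0 1 - {0}. ennreal (u (z * sgn \<xi>)) \<partial>lborel)"
    by (rule nn_integral_rotate) (use assms in \<open>auto simp: rotate_image_ball intro: open_delete\<close>)
  finally show ?thesis by (simp add: circ_mean_def)
qed

text \<open>By rotation invariance each of the \<open>n\<close> roots contributes the same circular
  mean.\<close>

lemma circ_mean_root_average:
  assumes [measurable]: "u \<in> borel_measurable borel" and nonneg: "\<And>z. 0 \<le> u z" and n: "n \<ge> 1"
  shows "(\<integral>\<^sup>+\<xi>\<in>ball 0 1 - {0}. ennreal (\<Sum>\<omega> | \<omega> ^ n = 1. u (\<omega> * (z * sgn \<xi>))) \<partial>lborel) = ennreal (real n) * circ_mean u z"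
proof -
  have "(\<integral>\<^sup>+\<xi>\<in>ball 0 1 - {0}. ennreal (\<Sum>\<omega> | \<omega> ^ n = 1. u (\<omega> * (z * sgn \<xi>))) \<partial>lborel)
     = (\<integral>\<^sup>+\<xi>. (\<Sum>\<omega> | \<omega> ^ n = 1. ennreal (u (\<omega> * (z * sgn \<xi>))) * indicator (ball 0 1 - {0}) \<xi>) \<partial>lborel)"
    using nonneg by (simp add: sum_ennreal[symmetric] sum_distrib_right del: sum_ennreal)
  also have "\<dots> = (\<Sum>\<omega> | \<omega> ^ n = 1. \<integral>\<^sup>+\<xi>\<in>ball 0 1 - {0}. ennreal (u (\<omega> * (z * sgn \<xi>))) \<partial>lborel)"
    by (rule nn_integral_sum) measurable
  also have "\<dots> = (\<Sum>\<omega> | (\<omega>::complex) ^ n = 1. circ_mean u z)"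
    using norm_root_of_unity n nonneg by (intro sum.cong refl circ_mean_rotate) auto
  also have "\<dots> = ennreal (real n) * circ_mean u z"
    using n by (simp add: card_complex_roots_unity ennreal_of_nat_eq_real_of_nat)
  finally show ?thesis .
qed

text \<open>The cut-off makes the function Borel on the whole plane, whatever the junk values of \<open>g\<close> off the disc.\<close>

definition disc_powr :: "real \<Rightarrow> (complex \<Rightarrow> complex) \<Rightarrow> complex \<Rightarrow> real" where
  "disc_powr p g z = norm (indicator (ball 0 1) z *\<^sub>R g z) powr p"

lemma disc_powr_eq: "z \<in> ball 0 1 \<Longrightarrow> disc_powr p g z = norm (g z) powr p"
  by (simp add: disc_powr_def)

lemma disc_powr_nonneg: "0 \<le> disc_powr p g z"
  by (simp add: disc_powr_def)

lemma borel_measurable_disc_powr: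
  assumes "g holomorphic_on ball 0 1"
  shows "disc_powr p g \<in> borel_measurable borel"
proof -
  have "(\<lambda>z. indicator (ball 0 1) z *\<^sub>R g z) \<in> borel_measurable borel"
    by (intro borel_measurable_continuous_on_indicator holomorphic_on_imp_continuous_on assms) auto
  then show ?thesis unfolding disc_powr_def by measurable
qed

text \<open>Integrated over all directions, a sum over the \<open>n\<close>-th roots of unity
  becomes \<open>n\<close> times the circular mean. Dividing the almost monotone inequality by
  \<open>n\<close> leaves an arbitrarily small error.\<close>

theorem circ_mean_mono:
  assumes hol: "g holomorphic_on ball 0 1" and p: "0 < p" and zw: "norm z \<le> norm w" "norm w < 1"
  shows "circ_mean (disc_powr p g) z \<le> circ_mean (disc_powr p g) w"
proof (rule ennreal_le_epsilon)
  fix e :: real assume e: "0 < e"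
  define u where "u = disc_powr p g"
  have [measurable]: "u \<in> borel_measurable borel"
    unfolding u_def by (rule borel_measurable_disc_powr[OF hol])
  have u0: "0 \<le> u x" for x by (simp add: u_def disc_powr_nonneg)
  \<comment> \<open>The directions range over a set of area \<open>pi\<close>, so an error of
    \<open>e / pi\<close> per root integrates to \<open>e\<close>.\<close>
  obtain n where n: "n \<ge> 1" and avg: "\<And>z' w'. norm z' \<le> norm w' \<Longrightarrow> norm w' = norm w \<Longrightarrow>
     (\<Sum>\<omega> | \<omega> ^ n = 1. norm (g (\<omega> * z')) powr p) \<le> (\<Sum>\<omega> | \<omega> ^ n = 1. norm (g (\<omega> * w')) powr p) + real n * (e / pi)"
    using root_average_almost_mono[OF hol p zw(2), of "e / pi"] e by auto
  have avgu: "(\<Sum>\<omega> | \<omega> ^ n = 1. u (\<omega> * (z * sgn \<xi>))) \<le> (\<Sum>\<omega> | \<omega> ^ n = 1. u (\<omega> * (w * sgn \<xi>))) + real n * (e / pi)"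
    if "\<xi> \<in> ball 0 1 - {0}" for \<xi>
  proof -
    have \<xi>: "norm (sgn \<xi>) = 1" using that by (simp add: norm_sgn)
    have "u (\<omega> * (x * sgn \<xi>)) = norm (g (\<omega> * (x * sgn \<xi>))) powr p" if "\<omega> ^ n = 1" "norm x < 1" for \<omega> x
      using norm_root_of_unity[OF n that(1)] that \<xi> unfolding u_def
      by (intro disc_powr_eq) (simp add: norm_mult)
    then show ?thesis
      using avg[of "z * sgn \<xi>" "w * sgn \<xi>"] zw \<xi> by (simp add: norm_mult)
  qed
  have "ennreal (real n) * circ_mean u z
    = (\<integral>\<^sup>+\<xi>\<in>ball 0 1 - {0}. ennreal (\<Sum>\<omega> | \<omega> ^ n = 1. u (\<omega> * (z * sgn \<xi>))) \<partial>lborel)"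
    by (rule circ_mean_root_average[symmetric]) (use n u0 in auto)
  also have "\<dots> \<le> (\<integral>\<^sup>+\<xi>. ennreal (\<Sum>\<omega> | \<omega> ^ n = 1. u (\<omega> * (w * sgn \<xi>))) * indicator (ball 0 1 - {0}) \<xi>
      + ennreal (real n * (e / pi)) * indicator (ball 0 1 - {0}) \<xi> \<partial>lborel)"
  proof (rule nn_integral_mono)
    fix \<xi> :: complex
    show "ennreal (\<Sum>\<omega> | \<omega> ^ n = 1. u (\<omega> * (z * sgn \<xi>))) * indicator (ball 0 1 - {0}) \<xi> \<le>
      ennreal (\<Sum>\<omega> | \<omega> ^ n = 1. u (\<omega> * (w * sgn \<xi>))) * indicator (ball 0 1 - {0}) \<xi>
      + ennreal (real n * (e / pi)) * indicator (ball 0 1 - {0}) \<xi>"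
      using avgu[of \<xi>] e u0
      by (cases "\<xi> \<in> ball 0 1 - {0}") (simp_all add: sum_nonneg ennreal_plus[symmetric] del: ennreal_plus)
  qed
  also have "\<dots> = (\<integral>\<^sup>+\<xi>\<in>ball 0 1 - {0}. ennreal (\<Sum>\<omega> | \<omega> ^ n = 1. u (\<omega> * (w * sgn \<xi>))) \<partial>lborel)
      + (\<integral>\<^sup>+\<xi>. ennreal (real n * (e / pi)) * indicator (ball 0 1 - {0 :: complex}) \<xi> \<partial>lborel)"
    by (rule nn_integral_add) measurable
  also have "\<dots> = ennreal (real n) * circ_mean u w + ennreal (real n * (e / pi)) * ennreal pi"
    by (subst circ_mean_root_average) (use n u0 in \<open>auto simp: nn_integral_cmult_indicator emeasure_punctured_disc\<close>)
  also have "ennreal (real n * (e / pi)) * ennreal pi = ennreal (real n) * ennreal e"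
    using e by (simp flip: ennreal_mult)
  finally have "ennreal (real n) * circ_mean u z \<le> ennreal (real n) * (circ_mean u w + ennreal e)"
    by (simp add: distrib_left)
  then show "circ_mean (disc_powr p g) z \<le> circ_mean (disc_powr p g) w + ennreal e"
    using n by (simp add: ennreal_mult_le_mult_iff u_def)
qed

text \<open>After Fubini the inner integral is over \<open>z\<close> with \<xi> fixed. The rotation
  by \<open>sgn \<xi>\<close> preserves the disc and the radial factor, so this integral does not
  depend on \<xi>; the factor \<open>pi\<close> is the area of the range of \<xi>.\<close>

lemma nn_integral_circ_mean:
  fixes \<rho> :: "real \<Rightarrow> real"
  assumes [measurable]: "u \<in> borel_measurable borel" "\<rho> \<in> borel_measurable borel"
    and nonneg: "\<And>z. 0 \<le> u z" "\<And>t. 0 \<le> \<rho> t"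
  shows "(\<integral>\<^sup>+z\<in>ball 0 1. circ_mean u z * ennreal (\<rho> (norm z)) \<partial>lborel)
       = ennreal pi * (\<integral>\<^sup>+z\<in>ball 0 1. ennreal (u z * \<rho> (norm z)) \<partial>lborel)"
proof -
  let ?D = "ball 0 1 :: complex set"
  have "(\<integral>\<^sup>+z\<in>?D. circ_mean u z * ennreal (\<rho> (norm z)) \<partial>lborel)
    = (\<integral>\<^sup>+z. \<integral>\<^sup>+\<xi>. ennreal (u (z * sgn \<xi>) * \<rho> (norm z)) * indicator ?D z * indicator (?D - {0}) \<xi> \<partial>lborel \<partial>lborel)"
    unfolding circ_mean_def
    by (intro nn_integral_cong, subst nn_integral_multc[symmetric], measurable, subst nn_integral_multc[symmetric], measurable)
       (auto intro!: nn_integral_cong simp: ennreal_mult nonneg mult_ac)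
  also have "\<dots> = (\<integral>\<^sup>+\<xi>. \<integral>\<^sup>+z. ennreal (u (z * sgn \<xi>) * \<rho> (norm z)) * indicator ?D z * indicator (?D - {0}) \<xi> \<partial>lborel \<partial>lborel)"
    by (rule lborel_pair.Fubini') measurable
  also have "\<dots> = (\<integral>\<^sup>+\<xi>\<in>?D - {0}. (\<integral>\<^sup>+z\<in>?D. ennreal (u (z * sgn \<xi>) * \<rho> (norm z)) \<partial>lborel) \<partial>lborel)"
    by (intro nn_integral_cong nn_integral_multc) measurable
  also have "\<dots> = (\<integral>\<^sup>+\<xi>\<in>?D - {0}. (\<integral>\<^sup>+z\<in>?D. ennreal (u z * \<rho> (norm z)) \<partial>lborel) \<partial>lborel)"
  proof (rule nn_integral_cong)
    fix \<xi> :: complex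
    have "(\<integral>\<^sup>+z\<in>?D. ennreal (u (z * sgn \<xi>) * \<rho> (norm z)) \<partial>lborel) = (\<integral>\<^sup>+z\<in>?D. ennreal (u z * \<rho> (norm z)) \<partial>lborel)"
      if "\<xi> \<noteq> 0"
    proof -
      have n: "norm (sgn \<xi>) = 1" using that by (simp add: norm_sgn)
      have "(\<integral>\<^sup>+z\<in>?D. ennreal ((\<lambda>z. u z * \<rho> (norm z)) (sgn \<xi> * z)) \<partial>lborel)
          = (\<integral>\<^sup>+z\<in>?D. ennreal (u z * \<rho> (norm z)) \<partial>lborel)"
        by (rule nn_integral_rotate) (use n nonneg in \<open>auto simp: rotate_image_ball\<close>)
      then show ?thesis using n by (simp add: norm_mult mult.commute)
    qed
    then show "(\<integral>\<^sup>+z\<in>?D. ennreal (u (z * sgn \<xi>) * \<rho> (norm z)) \<partial>lborel) * indicator (?D - {0}) \<xi>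
      = (\<integral>\<^sup>+z\<in>?D. ennreal (u z * \<rho> (norm z)) \<partial>lborel) * indicator (?D - {0}) \<xi>"
      by (simp add: indicator_def)
  qed
  also have "\<dots> = ennreal pi * (\<integral>\<^sup>+z\<in>ball 0 1. ennreal (u z * \<rho> (norm z)) \<partial>lborel)"
    by (subst nn_integral_cmult_indicator) (auto simp: emeasure_punctured_disc mult.commute)
  finally show ?thesis .
qed

section \<open>Integral inequality for similarly ordered functions\<close>

text \<open>With \<open>b = a + x\<close> and \<open>d = c + y\<close> the right side exceeds the
  left by \<open>x * y\<close>; this form avoids subtraction in \<open>ennreal\<close>.\<close>

lemma ennreal_rearrangement:
  fixes a b c d :: ennreal
  assumes "a \<le> b" "c \<le> d"
  shows "a * d + b * c \<le> a * c + b * d"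
proof -
  obtain x y where "b = a + x" "d = c + y"
    using assms by (auto simp: le_iff_add)
  then show ?thesis by (simp add: algebra_simps)
qed

text \<open>The rearrangement inequality holds at every pair of points. Integrated in both
  variables, it gives twice the claim.\<close>

lemma nn_integral_Chebyshev:
  fixes f g w :: "'a \<Rightarrow> ennreal"
  assumes "sigma_finite_measure M"
    and [measurable]: "f \<in> borel_measurable M" "g \<in> borel_measurable M"
    and mono: "\<And>x y. x \<in> space M \<Longrightarrow> y \<in> space M \<Longrightarrow> f x \<le> f y \<and> g x \<le> g y \<or> f y \<le> f x \<and> g y \<le> g x"
  shows "(\<integral>\<^sup>+x. f x \<partial>M) * (\<integral>\<^sup>+x. g x \<partial>M) \<le> emeasure M (space M) * (\<integral>\<^sup>+x. f x * g x \<partial>M)"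
proof -
  interpret sigma_finite_measure M by fact
  let ?F = "\<integral>\<^sup>+x. f x \<partial>M" and ?G = "\<integral>\<^sup>+x. g x \<partial>M" and ?P = "\<integral>\<^sup>+x. f x * g x \<partial>M" and ?m = "emeasure M (space M)"
  have "(\<integral>\<^sup>+x. \<integral>\<^sup>+y. f x * g y + f y * g x \<partial>M \<partial>M) \<le> (\<integral>\<^sup>+x. \<integral>\<^sup>+y. f x * g x + f y * g y \<partial>M \<partial>M)"
  proof (intro nn_integral_mono)
    fix x y assume "x \<in> space M" "y \<in> space M"
    with mono[of x y] show "f x * g y + f y * g x \<le> f x * g x + f y * g y"
      using ennreal_rearrangement[of "f x" "f y" "g x" "g y"] ennreal_rearrangement[of "f y" "f x" "g y" "g x"]
      by (auto simp: add_ac)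
  qed
  also have "(\<integral>\<^sup>+x. \<integral>\<^sup>+y. f x * g y + f y * g x \<partial>M \<partial>M) = 2 * (?F * ?G)"
    by (simp add: nn_integral_add nn_integral_cmult nn_integral_multc mult_2)
  also have "(\<integral>\<^sup>+x. \<integral>\<^sup>+y. f x * g x + f y * g y \<partial>M \<partial>M) = 2 * (?m * ?P)"
    by (simp add: nn_integral_add nn_integral_cmult nn_integral_multc mult_2 mult.commute)
  finally show ?thesis
    by (subst (asm) ennreal_mult_le_mult_iff) auto
qed

section \<open>Chebyshev inequality and zeros of higher order\<close>

lemma bergman_weight_nonneg: "\<alpha> > -1 \<Longrightarrow> 0 \<le> bergman_weight \<alpha> z"
  by (simp add: bergman_weight_def)

lemma bergman_integral_eq:
  "bergman_integral p \<alpha> f = (\<integral>\<^sup>+z\<in>ball 0 1. ennreal (disc_powr p f z * bergman_weight \<alpha> z) \<partial>lborel)"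
  unfolding bergman_integral_def
  by (intro nn_integral_cong) (auto simp: disc_powr_def bergman_weight_def indicator_def mult.assoc)

text \<open>The circular mean of the \<open>p\<close>-th power and \<open>norm z powr q\<close> both
  increase with \<open>norm z\<close>, so Chebyshev's inequality applies to them under the radial
  probability measure \<open>M\<close>. Passing from the function to its circular mean multiplies
  both integrals by \<open>pi\<close>, which cancels.\<close>

theorem bergman_integral_radial_Chebyshev:
  assumes hol: "g holomorphic_on ball 0 1" and p: "0 < p" and \<alpha>: "\<alpha> > -1" and q: "0 \<le> q"
  shows "bergman_integral p \<alpha> g * ennreal (Gamma (2 + \<alpha>) * Gamma (q / 2 + 1) / Gamma (q / 2 + 2 + \<alpha>))
     \<le> (\<integral>\<^sup>+z\<in>ball 0 1. ennreal (disc_powr p g z * norm z powr q * bergman_weight \<alpha> z) \<partial>lborel)"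
proof -
  let ?D = "ball 0 1 :: complex set"
  define u where "u = disc_powr p g"
  have [measurable]: "u \<in> borel_measurable borel"
    unfolding u_def by (rule borel_measurable_disc_powr[OF hol])
  have u0: "0 \<le> u x" for x by (simp add: u_def disc_powr_nonneg)
  define r where "r t = (\<alpha> + 1) * (1 - t\<^sup>2) powr \<alpha> / pi" for t :: real
  have [measurable]: "r \<in> borel_measurable borel" unfolding r_def by measurable
  have r0: "0 \<le> r t" for t using \<alpha> by (simp add: r_def)
  have rw: "r (norm z) = bergman_weight \<alpha> z" for z by (simp add: r_def bergman_weight_def)
  define M where "M = density lborel (\<lambda>z. ennreal (bergman_weight \<alpha> z) * indicator ?D z)"
  have M: "emeasure M (space M) = 1"
    unfolding M_def by (simp add: emeasure_density nn_integral_bergman_weight[OF \<alpha>])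
  interpret finite_measure M by (rule finite_measureI) (simp add: M)
  have int: "(\<integral>\<^sup>+z. f z * indicator ?D z \<partial>M) = (\<integral>\<^sup>+z\<in>?D. f z * ennreal (r (norm z)) \<partial>lborel)"
    if [measurable]: "f \<in> borel_measurable borel" for f
    unfolding M_def rw by (subst nn_integral_density) (auto intro!: nn_integral_cong simp: indicator_def mult_ac)
  \<comment> \<open>The indicators make both functions 0 off the disc, so they are similarly ordered
    on the whole plane, which is the space of \<open>M\<close>.\<close>
  let ?c = "\<lambda>z. circ_mean u z * indicator ?D z" and ?n = "\<lambda>z. ennreal (norm z powr q) * indicator ?D z"
  have "(\<integral>\<^sup>+z. ?c z \<partial>M) * (\<integral>\<^sup>+z. ?n z \<partial>M) \<le> emeasure M (space M) * (\<integral>\<^sup>+z. ?c z * ?n z \<partial>M)"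
  proof (rule nn_integral_Chebyshev)
    fix x y :: complex
    have "?c x \<le> ?c y \<and> ?n x \<le> ?n y" if "norm x \<le> norm y" "x \<in> ?D" "y \<in> ?D" for x y
      using circ_mean_mono[OF hol p that(1)] that q by (simp add: u_def powr_mono2)
    moreover have "?c x = 0 \<and> ?n x = 0" if "x \<notin> ?D" for x
      using that by simp
    ultimately show "?c x \<le> ?c y \<and> ?n x \<le> ?n y \<or> ?c y \<le> ?c x \<and> ?n y \<le> ?n x"
      by (metis linear zero_le)
  qed (unfold_locales, simp_all add: M_def)
  also have "(\<integral>\<^sup>+z. ?c z * ?n z \<partial>M) = (\<integral>\<^sup>+z. (circ_mean u z * ennreal (norm z powr q)) * indicator ?D z \<partial>M)"
    by (intro nn_integral_cong) (simp add: indicator_def)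
  also have "\<dots> = (\<integral>\<^sup>+z\<in>?D. circ_mean u z * ennreal ((\<lambda>t. t powr q * r t) (norm z)) \<partial>lborel)"
    by (subst int) (auto simp: ennreal_mult r0 mult_ac)
  also have "\<dots> = ennreal pi * (\<integral>\<^sup>+z\<in>?D. ennreal (u z * (\<lambda>t. t powr q * r t) (norm z)) \<partial>lborel)"
    by (rule nn_integral_circ_mean) (use u0 r0 in auto)
  also have "(\<integral>\<^sup>+z. ?c z \<partial>M) = (\<integral>\<^sup>+z\<in>?D. circ_mean u z * ennreal (r (norm z)) \<partial>lborel)"
    by (rule int) measurable
  also have "\<dots> = ennreal pi * (\<integral>\<^sup>+z\<in>?D. ennreal (u z * r (norm z)) \<partial>lborel)"
    by (rule nn_integral_circ_mean) (use u0 r0 in auto)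
  also have "(\<integral>\<^sup>+z\<in>?D. ennreal (u z * r (norm z)) \<partial>lborel) = bergman_integral p \<alpha> g"
    by (simp add: bergman_integral_eq u_def rw)
  also have "(\<integral>\<^sup>+z. ?n z \<partial>M) = (\<integral>\<^sup>+z\<in>?D. ennreal (norm z powr q) * ennreal (r (norm z)) \<partial>lborel)"
    by (rule int) measurable
  also have "\<dots> = ennreal (Gamma (2 + \<alpha>) * Gamma (q / 2 + 1) / Gamma (q / 2 + 2 + \<alpha>))"
    using nn_integral_norm_powr_bergman_weight[OF \<alpha> q] bergman_weight_nonneg[OF \<alpha>] by (simp add: rw ennreal_mult)
  finally have "ennreal pi * (bergman_integral p \<alpha> g * ennreal (Gamma (2 + \<alpha>) * Gamma (q / 2 + 1) / Gamma (q / 2 + 2 + \<alpha>)))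
     \<le> ennreal pi * (\<integral>\<^sup>+z\<in>?D. ennreal (u z * (norm z powr q * r (norm z))) \<partial>lborel)"
    by (simp add: M mult_ac)
  then show ?thesis
    by (subst (asm) ennreal_mult_le_mult_iff) (auto simp: u_def rw mult_ac)
qed

section \<open>Zeros of order \<open>N\<close> and powers of \<open>z - a\<close>\<close>

lemma higher_deriv_diff_const:
  "(deriv ^^ i) (\<lambda>w. w - a) = (if i = 0 then (\<lambda>w. w - a) else if i = 1 then (\<lambda>w. 1) else (\<lambda>w. 0 :: complex))"
proof (induction i)
  case (Suc i)
  then show ?case
    unfolding funpow.simps o_apply Suc.IH by (auto simp: fun_eq_iff)
qed auto

text \<open>In Leibniz's rule only the term with exactly one derivative on \<open>z - a\<close>
  survives at \<open>a\<close>. For \<open>k = 0\<close> both sides are 0, whatever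
  \<open>k - 1\<close> means.\<close>

lemma higher_deriv_linear_factor:
  assumes "h holomorphic_on S" "open S" "a \<in> S"
  shows "(deriv ^^ k) (\<lambda>z. (z - a) * h z) a = of_nat k * (deriv ^^ (k - 1)) h a"
proof -
  have "(deriv ^^ k) (\<lambda>z. (z - a) * h z) a
     = (\<Sum>i = 0..k. of_nat (k choose i) * (deriv ^^ i) (\<lambda>z. z - a) a * (deriv ^^ (k - i)) h a)"
    by (rule higher_deriv_mult) (use assms in \<open>auto intro!: holomorphic_intros\<close>)
  also have "\<dots> = (\<Sum>i = 0..k. if i = 1 then of_nat (k choose 1) * (deriv ^^ (k - 1)) h a else 0)"
    by (intro sum.cong refl) (simp add: higher_deriv_diff_const)
  also have "\<dots> = of_nat k * (deriv ^^ (k - 1)) h a"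
    by (cases k) (auto simp: sum.delta)
  finally show ?thesis .
qed

text \<open>One factor is split off at a time: the difference quotient at \<open>a\<close>,
  completed by the derivative, is holomorphic, and its derivatives at \<open>a\<close> vanish up to
  one order less.\<close>

lemma higher_deriv_zero_imp_factor:
  assumes "f holomorphic_on S" "open S" "a \<in> S" "\<forall>k<N. (deriv ^^ k) f a = 0"
  shows "\<exists>h. h holomorphic_on S \<and> (\<forall>z\<in>S. f z = (z - a) ^ N * h z)"
  using assms(1,4)
proof (induction N arbitrary: f)
  case (Suc N)
  have fa: "f a = 0" using Suc.prems(2) by (metis funpow_0 zero_less_Suc)
  define h where "h = (\<lambda>z. if z = a then deriv f a else (f z - f a) / (z - a))"
  have h: "h holomorphic_on S"
    unfolding h_def by (rule pole_lemma_open[OF Suc.prems(1) assms(2)])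
  have fh: "f z = (z - a) * h z" for z
    by (simp add: h_def fa)
  then have "f = (\<lambda>z. (z - a) * h z)" by blast
  then have "(deriv ^^ k) h a = 0" if "k < N" for k
    using higher_deriv_linear_factor[OF h assms(2,3), of "Suc k"] Suc.prems(2) that
    by (metis Suc_less_eq diff_Suc_1 mult_eq_0_iff of_nat_eq_0_iff nat.distinct(1))
  then obtain h' where "h' holomorphic_on S" "\<forall>z\<in>S. h z = (z - a) ^ N * h' z"
    using Suc.IH[OF h] by blast
  then show ?case
    by (intro exI[of _ h']) (simp add: fh)
qed auto

text \<open>Each factor \<open>z - a\<close> uses up one derivative, so fewer than \<open>N\<close>
  derivatives leave a zero.\<close>

lemma higher_deriv_factor_eq_zero:
  assumes "h holomorphic_on S" "open S" "a \<in> S" "k < N"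
  shows "(deriv ^^ k) (\<lambda>z. (z - a) ^ N * h z) a = 0"
  using assms(4)
proof (induction N arbitrary: k)
  case (Suc N)
  have "(deriv ^^ k) (\<lambda>z. (z - a) * ((z - a) ^ N * h z)) a = of_nat k * (deriv ^^ (k - 1)) (\<lambda>z. (z - a) ^ N * h z) a"
    by (rule higher_deriv_linear_factor) (use assms in \<open>auto intro!: holomorphic_intros\<close>)
  also have "\<dots> = 0"
    using Suc.IH[of "k - 1"] Suc.prems by (cases k) auto
  finally show ?case by (simp add: mult.assoc)
qed auto

section \<open>Disc automorphisms\<close>

text \<open>Besides nonvanishing, this keeps \<open>1 - cnj a * z\<close> off the branch cut of
  \<open>Ln\<close>.\<close>

lemma Re_one_minus_cnj_mult_pos:
  assumes "norm (a::complex) < 1" "norm z < 1"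
  shows "0 < Re (1 - cnj a * z)"
proof -
  have "Re (cnj a * z) \<le> norm (cnj a * z)" by (rule complex_Re_le_cmod)
  also have "\<dots> < 1" using mult_strict_mono[of "norm a" 1 "norm z" 1] assms by (simp add: norm_mult)
  finally show ?thesis by simp
qed

lemma one_minus_cnj_mult_nonzero:
  assumes "norm (a::complex) < 1" "norm z < 1"
  shows "1 - cnj a * z \<noteq> 0"
  using Re_one_minus_cnj_mult_pos[OF assms] by (metis less_irrefl zero_complex.simps(1))

lemma disc_aut_eq_Moebius: "disc_aut a z = - Moebius_function 0 a z"
  by (simp add: disc_aut_def Moebius_function_simple minus_divide_left)

lemma norm_disc_aut_less_1: "norm a < 1 \<Longrightarrow> norm z < 1 \<Longrightarrow> norm (disc_aut a z) < 1"
  by (simp add: disc_aut_eq_Moebius Moebius_function_norm_lt_1)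

lemma disc_aut_disc_aut:
  assumes "norm a < 1" "norm z < 1"
  shows "disc_aut a (disc_aut a z) = z"
proof -
  have nz: "1 - cnj a * z \<noteq> 0" "1 - cnj a * a \<noteq> 0"
    using one_minus_cnj_mult_nonzero assms by auto
  have "a - disc_aut a z = z * (1 - cnj a * a) / (1 - cnj a * z)"
    using nz by (simp add: disc_aut_def field_simps)
  moreover have "1 - cnj a * disc_aut a z = (1 - cnj a * a) / (1 - cnj a * z)"
    using nz by (simp add: disc_aut_def field_simps)
  ultimately show ?thesis
    using nz by (subst disc_aut_def) simp
qed

lemma holomorphic_disc_aut: "norm a < 1 \<Longrightarrow> disc_aut a holomorphic_on ball 0 1"
  unfolding disc_aut_def by (intro holomorphic_intros) (use one_minus_cnj_mult_nonzero in auto)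

lemma deriv_disc_aut:
  assumes "norm a < 1" "norm z < 1"
  shows "deriv (disc_aut a) z = (cnj a * a - 1) / (1 - cnj a * z)\<^sup>2"
  unfolding disc_aut_def using one_minus_cnj_mult_nonzero[OF assms]
  by (intro DERIV_imp_deriv) (auto intro!: derivative_eq_intros simp: power2_eq_square field_simps)

lemma norm_deriv_disc_aut:
  assumes "norm a < 1" "norm z < 1"
  shows "norm (deriv (disc_aut a) z) = (1 - (norm a)\<^sup>2) / (norm (1 - cnj a * z))\<^sup>2"
proof -
  have "cnj a * a - 1 = of_real ((norm a)\<^sup>2 - 1)"
    by (simp add: complex_norm_square mult.commute del: of_real_power)
  then have "norm (cnj a * a - 1) = 1 - (norm a)\<^sup>2"
    using assms by (simp only: norm_of_real) (simp add: abs_square_le_1)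
  then show ?thesis
    by (simp add: deriv_disc_aut[OF assms] norm_divide norm_power)
qed

text \<open>Rests on the identity for \<open>(norm (1 - cnj a * z))^2 - (norm (a - z))^2\<close>,
  which factors as \<open>(1 - (norm a)^2) * (1 - (norm z)^2)\<close>. It turns the weight at the
  image point into a power of the derivative times the weight at \<open>z\<close>.\<close>

lemma one_minus_norm_disc_aut:
  assumes "norm a < 1" "norm z < 1"
  shows "1 - (norm (disc_aut a z))\<^sup>2 = norm (deriv (disc_aut a) z) * (1 - (norm z)\<^sup>2)"
proof -
  have nz: "norm (1 - cnj a * z) \<noteq> 0"
    using one_minus_cnj_mult_nonzero[OF assms] by simp
  have "(norm (1 - cnj a * z))\<^sup>2 - (norm (a - z))\<^sup>2 = (1 - (norm a)\<^sup>2) * (1 - (norm z)\<^sup>2)"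
    by (simp add: cmod_power2) (simp add: power2_eq_square algebra_simps)
  then show ?thesis
    using nz by (simp add: norm_deriv_disc_aut[OF assms] disc_aut_def norm_divide power_divide field_simps)
qed

lemma disc_aut_image: "norm a < 1 \<Longrightarrow> disc_aut a ` ball 0 1 = ball 0 1"
  using norm_disc_aut_less_1 disc_aut_disc_aut
  by (auto simp: image_iff) (metis mem_ball_0)

lemma norm_deriv_disc_aut_pos:
  assumes "norm a < 1" "norm z < 1"
  shows "0 < norm (deriv (disc_aut a) z)"
  using one_minus_cnj_mult_nonzero[OF assms] assms
  by (simp add: norm_deriv_disc_aut[OF assms] abs_square_less_1)

text \<open>The chain rule for an involution, in modulus. It follows by using the preceding identity
  at \<open>z\<close> and at its image and cancelling \<open>1 - (norm z)^2\<close>.\<close>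

lemma deriv_disc_aut_involution:
  assumes "norm a < 1" "norm z < 1"
  shows "norm (deriv (disc_aut a) (disc_aut a z)) * norm (deriv (disc_aut a) z) = 1"
proof -
  have "1 - (norm z)\<^sup>2 = norm (deriv (disc_aut a) (disc_aut a z)) * norm (deriv (disc_aut a) z) * (1 - (norm z)\<^sup>2)"
    using one_minus_norm_disc_aut[OF assms(1) norm_disc_aut_less_1[OF assms]] one_minus_norm_disc_aut[OF assms]
    by (simp add: disc_aut_disc_aut[OF assms])
  moreover have "1 - (norm z)\<^sup>2 \<noteq> 0"
    using assms(2) abs_square_less_1[of "norm z"] by simp
  ultimately show ?thesis by simp
qed

section \<open>Conformal change of variables in weighted integrals\<close>

text \<open>In the exponent, 2 comes from the area Jacobian and \<alpha> from the weight.\<close>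

lemma nn_integral_disc_aut:
  assumes a: "norm a < 1" and \<alpha>: "\<alpha> > -1" and "F \<in> borel_measurable borel" and F0: "\<And>z. 0 \<le> F z"
  shows "(\<integral>\<^sup>+z\<in>ball 0 1. ennreal (F z * bergman_weight \<alpha> z) \<partial>lborel) =
     (\<integral>\<^sup>+z\<in>ball 0 1. ennreal (F (disc_aut a z) * norm (deriv (disc_aut a) z) powr (2 + \<alpha>) * bergman_weight \<alpha> z) \<partial>lborel)"
proof -
  have inj: "inj_on (disc_aut a) (ball 0 1)"
    by (rule inj_on_inverseI[of _ "disc_aut a"]) (use a disc_aut_disc_aut in simp)
  have "(\<integral>\<^sup>+z\<in>disc_aut a ` ball 0 1. ennreal (F z * bergman_weight \<alpha> z) \<partial>lborel) =
     (\<integral>\<^sup>+z\<in>ball 0 1. ennreal (F (disc_aut a z) * bergman_weight \<alpha> (disc_aut a z) * (norm (deriv (disc_aut a) z))\<^sup>2) \<partial>lborel)"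
    by (rule nn_integral_holomorphic_substitution[OF open_ball holomorphic_disc_aut[OF a] inj])
       (use assms F0 bergman_weight_nonneg[OF \<alpha>] in auto)
  also have "\<dots> = (\<integral>\<^sup>+z\<in>ball 0 1. ennreal (F (disc_aut a z) * norm (deriv (disc_aut a) z) powr (2 + \<alpha>) * bergman_weight \<alpha> z) \<partial>lborel)"
  proof (rule nn_integral_cong)
    fix z :: complex
    have "bergman_weight \<alpha> (disc_aut a z) * (norm (deriv (disc_aut a) z))\<^sup>2 = norm (deriv (disc_aut a) z) powr (2 + \<alpha>) * bergman_weight \<alpha> z"
      if z: "norm z < 1"
    proof -
      have "0 \<le> 1 - (norm z)\<^sup>2" using z by (simp add: abs_square_le_1)
      then show ?thesis
        using norm_deriv_disc_aut_pos[OF a z]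
        by (simp add: bergman_weight_def one_minus_norm_disc_aut[OF a z] powr_mult powr_add)
    qed
    then show "ennreal (F (disc_aut a z) * bergman_weight \<alpha> (disc_aut a z) * (norm (deriv (disc_aut a) z))\<^sup>2) * indicator (ball 0 1) z
      = ennreal (F (disc_aut a z) * norm (deriv (disc_aut a) z) powr (2 + \<alpha>) * bergman_weight \<alpha> z) * indicator (ball 0 1) z"
      by (simp add: indicator_def mult.assoc)
  qed
  finally show ?thesis by (simp add: disc_aut_image[OF a])
qed

text \<open>The negative of the derivative is \<open>(1 - (norm a)^2) / (1 - cnj a * z)^2\<close>,
  which has a holomorphic logarithm on the disc. Its multiple by \<open>s / p\<close> is
  exponentiated.\<close>

lemma holomorphic_power_of_deriv_disc_aut:
  assumes a: "norm a < 1" and p: "0 < p"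
  shows "\<exists>k. k holomorphic_on ball 0 1 \<and>
     (\<forall>z\<in>ball 0 1. norm (k z) powr p = norm (deriv (disc_aut a) z) powr s)"
proof (intro exI conjI ballI)
  let ?k = "\<lambda>z. exp (of_real (s / p) * (of_real (ln (1 - (norm a)\<^sup>2)) - 2 * Ln (1 - cnj a * z)))"
  show "?k holomorphic_on ball 0 1"
  proof (intro holomorphic_intros)
    fix z :: complex assume "z \<in> ball 0 1"
    then show "1 - cnj a * z \<notin> \<real>\<^sub>\<le>\<^sub>0"
      using Re_one_minus_cnj_mult_pos[OF a, of z] by (auto simp: complex_nonpos_Reals_iff)
  qed
  fix z :: complex assume "z \<in> ball 0 1"
  then have z: "norm z < 1" by simp
  have nz: "1 - cnj a * z \<noteq> 0" using one_minus_cnj_mult_nonzero[OF a z] .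
  have pos: "0 < 1 - (norm a)\<^sup>2" using a by (simp add: abs_square_less_1)
  have "norm (?k z) = exp (s / p * (ln (1 - (norm a)\<^sup>2) - 2 * ln (norm (1 - cnj a * z))))"
    using nz by simp
  also have "ln (1 - (norm a)\<^sup>2) - 2 * ln (norm (1 - cnj a * z)) = ln (norm (deriv (disc_aut a) z))"
    using nz pos by (simp add: norm_deriv_disc_aut[OF a z] ln_div ln_realpow)
  finally show "norm (?k z) powr p = norm (deriv (disc_aut a) z) powr s"
    using norm_deriv_disc_aut_pos[OF a z] p by (simp add: powr_def)
qed

lemma disc_powr_mult_disc_aut_power:
  assumes "N \<ge> 1"
  shows "disc_powr p (\<lambda>z. g z * disc_aut a z ^ N) z = disc_powr p g z * norm (disc_aut a z) powr (real N * p)"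
proof (cases "disc_aut a z = 0")
  case False
  then have "(norm (disc_aut a z) ^ N) powr p = norm (disc_aut a z) powr (real N * p)"
    by (simp add: powr_powr flip: powr_realpow)
  then show ?thesis
    by (simp add: disc_powr_def norm_mult norm_power powr_mult)
\<comment> \<open>At a zero of the automorphism both sides are 0, as \<open>N \<ge> 1\<close>; for
  \<open>N = 0\<close> the convention \<open>0 powr 0 = 0\<close> would break the equation.\<close>
qed (use assms in \<open>simp add: disc_powr_def power_0_left\<close>)

text \<open>The function \<open>k\<close> absorbs the power of the derivative, and since
  \<open>disc_aut a\<close> is an involution, its \<open>N\<close>-th power becomes the radial
  factor \<open>norm z powr (N * p)\<close>.\<close>

lemma bergman_integral_disc_aut:
  assumes a: "norm a < 1" and p: "0 < p" and \<alpha>: "\<alpha> > -1" and N: "N \<ge> 1" and g: "g holomorphic_on ball 0 1"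
    and k: "\<And>z. z \<in> ball 0 1 \<Longrightarrow> norm (k z) powr p = norm (deriv (disc_aut a) z) powr (2 + \<alpha>)"
  shows "bergman_integral p \<alpha> g = bergman_integral p \<alpha> (\<lambda>z. g (disc_aut a z) * k z)"
    and "bergman_integral p \<alpha> (\<lambda>z. g z * disc_aut a z ^ N) =
      (\<integral>\<^sup>+z\<in>ball 0 1. ennreal (disc_powr p (\<lambda>z. g (disc_aut a z) * k z) z * norm z powr (real N * p) * bergman_weight \<alpha> z) \<partial>lborel)"
proof -
  have mg: "disc_powr p g \<in> borel_measurable borel"
    by (rule borel_measurable_disc_powr[OF g])
  have "(\<lambda>z. g z * disc_aut a z ^ N) holomorphic_on ball 0 1"
    by (intro holomorphic_intros g holomorphic_disc_aut a)
  then have mf: "disc_powr p (\<lambda>z. g z * disc_aut a z ^ N) \<in> borel_measurable borel"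
    by (rule borel_measurable_disc_powr)
  have *: "disc_powr p g (disc_aut a z) * norm (deriv (disc_aut a) z) powr (2 + \<alpha>) = disc_powr p (\<lambda>z. g (disc_aut a z) * k z) z"
    if "norm z < 1" for z
    using that k[of z] norm_disc_aut_less_1[OF a that] by (simp add: disc_powr_eq norm_mult powr_mult)
  show "bergman_integral p \<alpha> g = bergman_integral p \<alpha> (\<lambda>z. g (disc_aut a z) * k z)"
    unfolding bergman_integral_eq nn_integral_disc_aut[OF a \<alpha> mg disc_powr_nonneg]
    by (intro nn_integral_cong) (simp add: indicator_def *)
  show "bergman_integral p \<alpha> (\<lambda>z. g z * disc_aut a z ^ N) =
      (\<integral>\<^sup>+z\<in>ball 0 1. ennreal (disc_powr p (\<lambda>z. g (disc_aut a z) * k z) z * norm z powr (real N * p) * bergman_weight \<alpha> z) \<partial>lborel)"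
    unfolding bergman_integral_eq nn_integral_disc_aut[OF a \<alpha> mf disc_powr_nonneg]
  proof (rule nn_integral_cong)
    fix z :: complex
    show "ennreal (disc_powr p (\<lambda>z. g z * disc_aut a z ^ N) (disc_aut a z) * norm (deriv (disc_aut a) z) powr (2 + \<alpha>) * bergman_weight \<alpha> z) * indicator (ball 0 1) z
      = ennreal (disc_powr p (\<lambda>z. g (disc_aut a z) * k z) z * norm z powr (real N * p) * bergman_weight \<alpha> z) * indicator (ball 0 1) z"
    proof (cases "norm z < 1")
      case True
      then show ?thesis
        by (simp only: disc_powr_mult_disc_aut_power[OF N] disc_aut_disc_aut[OF a True] *[OF True, symmetric]) (simp only: mult_ac)
    qed simp
  qed
qed

theorem bergman_integral_le_disc_aut_power:
  assumes a: "norm a < 1" and p: "0 < p" and \<alpha>: "\<alpha> > -1" and N: "N \<ge> 1" and g: "g holomorphic_on ball 0 1"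
  shows "bergman_integral p \<alpha> g * ennreal (Gamma (2 + \<alpha>) * Gamma (real N * p / 2 + 1) / Gamma (real N * p / 2 + 2 + \<alpha>))
    \<le> bergman_integral p \<alpha> (\<lambda>z. g z * disc_aut a z ^ N)"
proof -
  obtain k where k: "k holomorphic_on ball 0 1"
     "\<And>z. z \<in> ball 0 1 \<Longrightarrow> norm (k z) powr p = norm (deriv (disc_aut a) z) powr (2 + \<alpha>)"
    using holomorphic_power_of_deriv_disc_aut[OF a p] by blast
  have "(g \<circ> disc_aut a) holomorphic_on ball 0 1"
    by (rule holomorphic_on_compose_gen[OF holomorphic_disc_aut[OF a] g]) (simp add: disc_aut_image[OF a])
  then have "(\<lambda>z. g (disc_aut a z) * k z) holomorphic_on ball 0 1"
    using k by (auto simp: o_def intro!: holomorphic_intros)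
  from bergman_integral_radial_Chebyshev[OF this p \<alpha>, of "real N * p"] show ?thesis
    using p by (simp only: bergman_integral_disc_aut[OF a p \<alpha> N g k(2)]) simp
qed

text \<open>For \<open>g = k\<close> the transformed function has modulus 1: its \<open>p\<close>-th
  power is that of the product of the derivatives at \<open>z\<close> and at its image, which is 1
  for an involution. Both integrals are then moments of the weight.\<close>

lemma bergman_integral_extremal:
  assumes a: "norm a < 1" and p: "0 < p" and \<alpha>: "\<alpha> > -1" and N: "N \<ge> 1"
  shows "\<exists>k. k holomorphic_on ball 0 1 \<and> (\<forall>z\<in>ball 0 1. k z \<noteq> 0) \<and> bergman_integral p \<alpha> k = 1 \<and>
    bergman_integral p \<alpha> (\<lambda>z. k z * disc_aut a z ^ N)
    = ennreal (Gamma (2 + \<alpha>) * Gamma (real N * p / 2 + 1) / Gamma (real N * p / 2 + 2 + \<alpha>))"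
proof -
  obtain k where k: "k holomorphic_on ball 0 1"
     "\<And>z. z \<in> ball 0 1 \<Longrightarrow> norm (k z) powr p = norm (deriv (disc_aut a) z) powr (2 + \<alpha>)"
    using holomorphic_power_of_deriv_disc_aut[OF a p] by blast
  have k1: "disc_powr p (\<lambda>z. k (disc_aut a z) * k z) z = 1" if "norm z < 1" for z
  proof -
    have "disc_powr p (\<lambda>z. k (disc_aut a z) * k z) z = norm (k (disc_aut a z)) powr p * norm (k z) powr p"
      using that by (simp add: disc_powr_eq norm_mult powr_mult)
    also have "\<dots> = (norm (deriv (disc_aut a) (disc_aut a z)) * norm (deriv (disc_aut a) z)) powr (2 + \<alpha>)"
      using that norm_disc_aut_less_1[OF a that] k(2) by (simp add: powr_mult)
    finally show ?thesis by (simp add: deriv_disc_aut_involution[OF a that])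
  qed
  have "k z \<noteq> 0" if "z \<in> ball 0 1" for z
    using k(2)[OF that] norm_deriv_disc_aut_pos[OF a, of z] that by auto
  moreover have "bergman_integral p \<alpha> k = 1"
  proof -
    have "bergman_integral p \<alpha> k = bergman_integral p \<alpha> (\<lambda>z. k (disc_aut a z) * k z)"
      by (rule bergman_integral_disc_aut(1)[OF a p \<alpha> N k])
    also have "\<dots> = (\<integral>\<^sup>+z\<in>ball 0 1. ennreal (bergman_weight \<alpha> z) \<partial>lborel)"
      unfolding bergman_integral_eq
      by (intro nn_integral_cong) (simp add: indicator_def k1)
    finally show ?thesis by (simp add: nn_integral_bergman_weight[OF \<alpha>])
  qed
  moreover have "bergman_integral p \<alpha> (\<lambda>z. k z * disc_aut a z ^ N)
    = ennreal (Gamma (2 + \<alpha>) * Gamma (real N * p / 2 + 1) / Gamma (real N * p / 2 + 2 + \<alpha>))"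
  proof -
    note bergman_integral_disc_aut(2)[OF a p \<alpha> N k]
    also have "(\<integral>\<^sup>+z\<in>ball 0 1. ennreal (disc_powr p (\<lambda>z. k (disc_aut a z) * k z) z * norm z powr (real N * p) * bergman_weight \<alpha> z) \<partial>lborel)
       = (\<integral>\<^sup>+z\<in>ball 0 1. ennreal (norm z powr (real N * p) * bergman_weight \<alpha> z) \<partial>lborel)"
      by (intro nn_integral_cong) (simp add: indicator_def k1)
    finally show ?thesis
      using nn_integral_norm_powr_bergman_weight[OF \<alpha>, of "real N * p"] p by simp
  qed
  ultimately show ?thesis using k(1) by blast
qed

lemma bergman_integral_cong:
  "(\<And>z. z \<in> ball 0 1 \<Longrightarrow> f z = g z) \<Longrightarrow> bergman_integral p \<alpha> f = bergman_integral p \<alpha> g"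
  unfolding bergman_integral_def by (intro nn_integral_cong) (simp add: indicator_def)

lemma disc_aut_power_mult_factor:
  assumes a: "norm a < 1" and z: "norm z < 1"
  shows "(z - a) ^ N * h = ((- 1) ^ N * (1 - cnj a * z) ^ N * h) * disc_aut a z ^ N"
proof -
  have "z - a = - 1 * (1 - cnj a * z) * disc_aut a z"
    using one_minus_cnj_mult_nonzero[OF a z] by (simp add: disc_aut_def field_simps)
  then have "(z - a) ^ N = (- 1 * (1 - cnj a * z) * disc_aut a z) ^ N" by (rule arg_cong)
  then show ?thesis by (simp only: power_mult_distrib) (simp add: mult_ac)
qed

lemma disc_aut_eq_0_iff: "norm a < 1 \<Longrightarrow> norm z < 1 \<Longrightarrow> disc_aut a z = 0 \<longleftrightarrow> z = a"
  using one_minus_cnj_mult_nonzero[of a z] by (auto simp: disc_aut_def)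

lemma Gamma_bergman_pos:
  assumes "0 < p" "\<alpha> > -1"
  shows "Gamma (2 + \<alpha>) > 0" "Gamma (real N * p / 2 + 1) > 0" "Gamma (real N * p / 2 + 2 + \<alpha>) > 0"
proof -
  have "0 \<le> real N * p / 2" using assms by simp
  with assms have "2 + \<alpha> > 0" "real N * p / 2 + 1 > 0" "real N * p / 2 + 2 + \<alpha> > 0" by linarith+
  then show "Gamma (2 + \<alpha>) > 0" "Gamma (real N * p / 2 + 1) > 0" "Gamma (real N * p / 2 + 2 + \<alpha>) > 0"
    by (auto intro: Gamma_real_pos)
qed

section \<open>The norm estimate and its sharpness\<close>

text \<open>Here \<open>f = (z - a)^N * h\<close>, and trading each \<open>z - a\<close> for
  \<open>disc_aut a z\<close> moves the zero-free factor \<open>- (1 - cnj a * z)\<close> into the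
  quotient \<open>g\<close>. The integral inequality then needs only a \<open>p\<close>-th
  root.\<close>

lemma zeros_quotient_bergman:
  fixes p \<alpha> :: real
  defines "C N \<equiv> Gamma (real N * p / 2 + 2 + \<alpha>) / (Gamma (2 + \<alpha>) * Gamma (real N * p / 2 + 1))"
  assumes a: "norm a < 1" and p: "0 < p" and \<alpha>: "\<alpha> > -1" and N: "N \<ge> 1"
    and f: "in_bergman p \<alpha> f" "\<forall>k<N. (deriv ^^ k) f a = 0"
  shows "\<exists>g. g holomorphic_on ball 0 1 \<and> (\<forall>z\<in>ball 0 1 - {a}. g z = f z / (disc_aut a z) ^ N) \<and>
    in_bergman p \<alpha> g \<and> bergman_norm p \<alpha> g \<le> C N powr (1 / p) * bergman_norm p \<alpha> f"
proof -
  have holf: "f holomorphic_on ball 0 1" and fin: "bergman_integral p \<alpha> f < \<infinity>"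
    using f by (auto simp: in_bergman_def)
  obtain h where h: "h holomorphic_on ball 0 1" "\<And>z. z \<in> ball 0 1 \<Longrightarrow> f z = (z - a) ^ N * h z"
    using higher_deriv_zero_imp_factor[OF holf _ _ f(2)] a by auto
  define g where "g z = (- 1) ^ N * (1 - cnj a * z) ^ N * h z" for z
  have g: "g holomorphic_on ball 0 1"
    unfolding g_def by (intro holomorphic_intros h)
  have fg: "f z = g z * disc_aut a z ^ N" if "z \<in> ball 0 1" for z
    using disc_aut_power_mult_factor[OF a] that by (simp add: h(2) g_def)
  define K where "K = Gamma (2 + \<alpha>) * Gamma (real N * p / 2 + 1) / Gamma (real N * p / 2 + 2 + \<alpha>)"
  have K: "K > 0" "C N = 1 / K"
    using Gamma_bergman_pos(1)[OF p \<alpha>] Gamma_bergman_pos(2,3)[OF p \<alpha>, of N] by (auto simp: K_def C_def)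
  have le: "bergman_integral p \<alpha> g * ennreal K \<le> bergman_integral p \<alpha> f"
    using bergman_integral_le_disc_aut_power[OF a p \<alpha> N g] bergman_integral_cong[OF fg] by (simp add: K_def)
  \<comment> \<open>A finite product with the positive factor \<open>K\<close> forces the integral
    itself to be finite.\<close>
  have fing: "bergman_integral p \<alpha> g < \<infinity>"
    using le_less_trans[OF le fin] K by (auto simp: ennreal_mult_less_top less_top)
  have "enn2real (bergman_integral p \<alpha> g * ennreal K) \<le> enn2real (bergman_integral p \<alpha> f)"
    using le fin by (intro enn2real_mono) auto
  then have "enn2real (bergman_integral p \<alpha> g) \<le> C N * enn2real (bergman_integral p \<alpha> f)"
    using K(1) by (simp add: K(2) enn2real_mult pos_le_divide_eq)
  then have "bergman_norm p \<alpha> g \<le> (C N * enn2real (bergman_integral p \<alpha> f)) powr (1 / p)"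
    unfolding bergman_norm_def using p by (intro powr_mono2) auto
  also have "\<dots> = C N powr (1 / p) * bergman_norm p \<alpha> f"
    unfolding bergman_norm_def using K by (subst powr_mult) auto
  finally show ?thesis
    using g fg fing disc_aut_eq_0_iff[OF a] by (intro exI[of _ g]) (auto simp: in_bergman_def)
qed

text \<open>The analytic extension of the quotient is expressed by a holomorphic \<open>g\<close>
  that agrees with it off \<open>a\<close>; by continuity \<open>g\<close> is unique on the
  disc.\<close>

theorem theorem3p3:
  fixes p \<alpha> :: real and a :: complex and N :: nat
  assumes "0 < p" and "\<alpha> > -1" and "a \<in> ball 0 1" and "N \<ge> 1"
  shows
   "(\<forall>f. in_bergman p \<alpha> f \<and> (\<forall>k<N. (deriv ^^ k) f a = 0) \<longrightarrow>
       (\<exists>g. g holomorphic_on ball 0 1 \<and>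
            (\<forall>z\<in>ball 0 1 - {a}. g z = f z / (disc_aut a z) ^ N) \<and>
            in_bergman p \<alpha> g \<and>
            bergman_norm p \<alpha> g \<le>
              (Gamma (real N * p / 2 + 2 + \<alpha>) / (Gamma (2 + \<alpha>) * Gamma (real N * p / 2 + 1))) powr (1 / p)
              * bergman_norm p \<alpha> f))
    \<and> (\<exists>f. in_bergman p \<alpha> f \<and> (\<exists>z\<in>ball 0 1. f z \<noteq> 0) \<and> (\<forall>k<N. (deriv ^^ k) f a = 0) \<and>
         (\<exists>g. g holomorphic_on ball 0 1 \<and>
            (\<forall>z\<in>ball 0 1 - {a}. g z = f z / (disc_aut a z) ^ N) \<and>
            in_bergman p \<alpha> g \<and>
            bergman_norm p \<alpha> g =
              (Gamma (real N * p / 2 + 2 + \<alpha>) / (Gamma (2 + \<alpha>) * Gamma (real N * p / 2 + 1))) powr (1 / p)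
              * bergman_norm p \<alpha> f))
    \<and> (\<forall>f. in_bergman p 0 f \<and> f a = 0 \<longrightarrow>
       (\<exists>g. g holomorphic_on ball 0 1 \<and>
            (\<forall>z\<in>ball 0 1 - {a}. g z = f z / disc_aut a z) \<and>
            in_bergman p 0 g \<and>
            bergman_norm p 0 g \<le> ((p + 2) / 2) powr (1 / p) * bergman_norm p 0 f))"
proof (intro conjI allI impI)
  note p = assms(1) and \<alpha> = assms(2) and N = assms(4)
  have a: "norm a < 1" using assms(3) by simp
  define C where "C = Gamma (real N * p / 2 + 2 + \<alpha>) / (Gamma (2 + \<alpha>) * Gamma (real N * p / 2 + 1))"
  show "\<exists>g. g holomorphic_on ball 0 1 \<and>
            (\<forall>z\<in>ball 0 1 - {a}. g z = f z / (disc_aut a z) ^ N) \<and>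
            in_bergman p \<alpha> g \<and>
            bergman_norm p \<alpha> g \<le>
              (Gamma (real N * p / 2 + 2 + \<alpha>) / (Gamma (2 + \<alpha>) * Gamma (real N * p / 2 + 1))) powr (1 / p)
              * bergman_norm p \<alpha> f"
    if "in_bergman p \<alpha> f \<and> (\<forall>k<N. (deriv ^^ k) f a = 0)" for f
    using zeros_quotient_bergman[OF a p \<alpha> N] that by blast
  show "\<exists>g. g holomorphic_on ball 0 1 \<and>
            (\<forall>z\<in>ball 0 1 - {a}. g z = f z / disc_aut a z) \<and>
            in_bergman p 0 g \<and>
            bergman_norm p 0 g \<le> ((p + 2) / 2) powr (1 / p) * bergman_norm p 0 f"
    if "in_bergman p 0 f \<and> f a = 0" for f
  proof -
    have G: "Gamma (p / 2 + 1) > 0" using p by (intro Gamma_real_pos) simp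
    have "p / 2 + 1 \<notin> \<int>\<^sub>\<le>\<^sub>0" using p by (auto simp: nonpos_Ints_def)
    then have "Gamma (p / 2 + 2) = (p / 2 + 1) * Gamma (p / 2 + 1)"
      using Gamma_plus1[of "p / 2 + 1"] by (simp add: add.assoc)
    moreover have "Gamma 2 = (1 :: real)"
      using Gamma_fact[of 1, where 'a = real] by simp
    ultimately have C1: "Gamma (p / 2 + 2) / (Gamma 2 * Gamma (p / 2 + 1)) = (p + 2) / 2"
      using G by (simp add: field_simps)
    show ?thesis
      using zeros_quotient_bergman[OF a p, of 0 1 f] that by (simp add: C1)
  qed
  show "\<exists>f. in_bergman p \<alpha> f \<and> (\<exists>z\<in>ball 0 1. f z \<noteq> 0) \<and> (\<forall>k<N. (deriv ^^ k) f a = 0) \<and>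
         (\<exists>g. g holomorphic_on ball 0 1 \<and>
            (\<forall>z\<in>ball 0 1 - {a}. g z = f z / (disc_aut a z) ^ N) \<and>
            in_bergman p \<alpha> g \<and>
            bergman_norm p \<alpha> g =
              (Gamma (real N * p / 2 + 2 + \<alpha>) / (Gamma (2 + \<alpha>) * Gamma (real N * p / 2 + 1))) powr (1 / p)
              * bergman_norm p \<alpha> f)"
  proof -
    define K where "K = Gamma (2 + \<alpha>) * Gamma (real N * p / 2 + 1) / Gamma (real N * p / 2 + 2 + \<alpha>)"
    have K: "K > 0" "C = 1 / K"
      using Gamma_bergman_pos(1)[OF p \<alpha>] Gamma_bergman_pos(2,3)[OF p \<alpha>, of N] by (auto simp: K_def C_def)
    obtain k where k: "k holomorphic_on ball 0 1" "\<And>z. z \<in> ball 0 1 \<Longrightarrow> k z \<noteq> 0" "bergman_integral p \<alpha> k = 1"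
       "bergman_integral p \<alpha> (\<lambda>z. k z * disc_aut a z ^ N) = ennreal K"
      using bergman_integral_extremal[OF a p \<alpha> N] unfolding K_def by blast
    \<comment> \<open>The extremal function: its quotient is the zero-free \<open>k\<close> with
      integral 1, while its own integral is \<open>K = 1 / C\<close>.\<close>
    define f where "f z = k z * disc_aut a z ^ N" for z
    have f: "f holomorphic_on ball 0 1"
      unfolding f_def by (intro holomorphic_intros k holomorphic_disc_aut a)
    obtain z :: complex where z: "z \<in> ball 0 1" "z \<noteq> a"
    proof (cases "a = 0")
      case True
      show ?thesis by (rule that[of "1/2"]) (use True in auto)
    next
      case False
      show ?thesis by (rule that[of 0]) (use False in auto)
    qed
    have "(deriv ^^ j) f a = 0" if "j < N" for j
    proof -
      \<comment> \<open>The cofactor of \<open>(z - a)^N\<close> in \<open>f\<close>; the sign comes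
        from the numerator \<open>a - z\<close> of the automorphism.\<close>
      let ?h = "\<lambda>z. (- 1) ^ N * k z / (1 - cnj a * z) ^ N"
      have h: "?h holomorphic_on ball 0 1"
        by (intro holomorphic_intros k) (use one_minus_cnj_mult_nonzero[OF a] in auto)
      have "(deriv ^^ j) f a = (deriv ^^ j) (\<lambda>z. (z - a) ^ N * ?h z) a"
      proof (rule higher_deriv_transform_within_open[OF f])
        show "(\<lambda>z. (z - a) ^ N * ?h z) holomorphic_on ball 0 1"
          by (intro holomorphic_intros h)
        fix w :: complex assume w: "w \<in> ball 0 1"
        then have nz: "1 - cnj a * w \<noteq> 0" using one_minus_cnj_mult_nonzero[OF a] by simp
        have "(- 1) ^ N * (1 - cnj a * w) ^ N * ?h w = ((- 1) ^ N * (- 1) ^ N) * k w"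
          using nz by simp
        also have "(- 1) ^ N * (- 1) ^ N = (1::complex)"
          by (simp flip: power_mult_distrib)
        finally show "f w = (w - a) ^ N * ?h w"
          using disc_aut_power_mult_factor[OF a, of w N "?h w"] w by (simp only: f_def mem_ball_0 mult_1)
      qed (use a in auto)
      also have "\<dots> = 0"
        by (rule higher_deriv_factor_eq_zero[OF h _ _ that]) (use a in auto)
      finally show ?thesis .
    qed
    moreover have "f z \<noteq> 0"
      using z k(2)[of z] disc_aut_eq_0_iff[OF a, of z] by (simp add: f_def)
    moreover have "bergman_norm p \<alpha> k = C powr (1 / p) * bergman_norm p \<alpha> f"
      using K k(3,4) unfolding bergman_norm_def f_def
      by (simp flip: powr_mult)
    moreover have "in_bergman p \<alpha> f" "in_bergman p \<alpha> k"
      using k f by (auto simp: in_bergman_def f_def[symmetric] cong: bergman_integral_cong)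
    moreover have "k w = f w / disc_aut a w ^ N" if "w \<in> ball 0 1 - {a}" for w
      using that disc_aut_eq_0_iff[OF a, of w] by (simp add: f_def)
    ultimately show ?thesis
      using k(1) z(1) unfolding C_def by (intro exI[of _ f] conjI exI[of _ k]) auto
  qed
qed

end
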